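(* Let $F\in \mathrm{C}^{k,m}(\mathcal{M}_F(\mathbb{R}^d))$ for some $k\in\{0,1,2\}$ and some integer $m\geq 0$. Then there exists a sequence $\{F_n\}_{n\geq 1}$ in $\mathrm{C}_P^k(\mathcal{M}_F(\mathbb{R}^d))$ such that for all $\mu\in\mathcal{M}_F(\mathbb{R}^d)$ $$F_n(\mu)\to F(\mu),\quad n\to\infty,$$ $$F_n'(\mu;\cdot)\to F'(\mu;\cdot)\ \text{ in } \mathrm{C}^m(\mathbb{R}^d),\quad n\to\infty,\quad\text{if } k\geq 1,$$ and $$F_n''(\mu;\cdot)\to F''(\mu;\cdot)\ \text{ in } \mathrm{C}^m(\mathbb{R}^{2d}),\quad n\to\infty,\quad\text{if } k=2.$$ Moreover, if for some $C>0$ the functions $F$, $F'$ (if $k\ge1$) and $F''$ (if $k=2$) and their derivatives (in the space variables, up to order $m$) are bounded on the sets $\mathcal{N}_C$, $\mathcal{N}_C\times\mathbb{R}^d$ and $\mathcal{N}_C\times\mathbb{R}^{2d}$, respectively, then the sequence $\{F_n\}_{n\geq 1}$ can be chosen so that $\{F_n\}_{n\ge1}$, $\{F_n'\}_{n\ge1}$ (if $k\ge1$), $\{F_n''\}_{n\ge1}$ (if $k=2$) and their derivatives are uniformly bounded in $n$ on $\mathcal{N}_C$, $\mathcal{N}_C\times\mathbb{R}^d$ and $\mathcal{N}_C\times\mathbb{R}^{2d}$, respectively.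
   Context: $\mathcal{M}_F(\mathbb{R}^d)$ is the set of finite (nonnegative Borel) measures on $\mathbb{R}^d$ with the weak topology (convergence of $\langle\varphi,\mu\rangle:=\int\varphi\,d\mu$ for all bounded continuous $\varphi$); $\mathcal{N}_C:=\{\mu\in\mathcal{M}_F(\mathbb{R}^d):\mu(\mathbb{R}^d)\le C\}$. $\mathrm{C}^m(\mathbb{R}^d)$ is the space of $m$ times continuously differentiable functions, with the topology of uniform convergence on compact sets of all derivatives up to order $m$. Let $\mathrm{C}(\mathcal{M}_F)$ be the set of continuous functions $\mathcal{M}_F(\mathbb{R}^d)\to\mathbb{R}$. For $F\in \mathrm{C}(\mathcal{M}_F)$ put $$F'(\mu;x):=\lim_{\varepsilon\to0+}\frac{F(\mu+\varepsilon\delta_x)-F(\mu)}{\varepsilon},\qquad F''(\mu;x,y):=\frac{\partial^2}{\partial\varepsilon_1\partial\varepsilon_2}F(\mu+\varepsilon_1\delta_x+\varepsilon_2\delta_y)\Big|_{\varepsilon_1=\varepsilon_2=0}$$ (one-sided derivatives, $\varepsilon_i\ge0$). Define $\mathrm{C}^{0,m}(\mathcal{M}_F):=\mathrm{C}(\mathcal{M}_F)$; $\mathrm{C}^{1,m}(\mathcal{M}_F)$ is the set of $F\in \mathrm{C}(\mathcal{M}_F)$ such that $F'$ exists everywhere, $F'(\mu;\cdot)\in \mathrm{C}^m(\mathbb{R}^d)$ for all $\mu$, and $F'$ and its $x$-derivatives up to order $m$ are jointly continuous in $(\mu,x)$; $\mathrm{C}^{2,m}(\mathcal{M}_F)$ is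 the set of $F\in \mathrm{C}^{1,m}(\mathcal{M}_F)$ such that $F''$ exists everywhere, $F''(\mu;\cdot)\in \mathrm{C}^m(\mathbb{R}^{2d})$ for all $\mu$, and $F''$ and its $(x,y)$-derivatives up to order $m$ are jointly continuous in $(\mu,x,y)$. $\mathrm{C}^k_P(\mathcal{M}_F(\mathbb{R}^d))$ is the set of functions on $\mathcal{M}_F(\mathbb{R}^d)$ of the form $G(\mu)=u(\langle\varphi_1,\mu\rangle,\ldots,\langle\varphi_p,\mu\rangle)$, where $p\in\mathbb{N}$, $\varphi_1,\ldots,\varphi_p$ are nonnegative smooth functions on $\mathbb{R}^d$ with compact supports, and $u\in \mathrm{C}^k([0,+\infty)^p)$, i.e. $u$ is continuous on $[0,\infty)^p$, $k$ times continuously differentiable in the interior, with derivatives up to order $k$ extending continuously to $[0,\infty)^p$. *)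

theory Defs
  imports "HOL-Probability.Probability"
begin

section \<open>The space of finite Borel measures with the weak topology\<close>

definition finite_measures :: "'a::euclidean_space measure set" where
  "finite_measures = {\<mu>. sets \<mu> = sets borel \<and> finite_measure \<mu>}"

text \<open>The coarsest topology making all \<open>\<mu> \<mapsto> \<integral>\<phi> d\<mu>\<close> with \<open>\<phi>\<close> bounded and continuous
  continuous.\<close>

definition weak_topology :: "'a::euclidean_space measure topology" where
  "weak_topology = topology_generated_by
     {{\<mu> \<in> finite_measures. (\<integral>x. \<phi> x \<partial>\<mu>) \<in> U} | (\<phi> :: 'a \<Rightarrow> real) U.
        continuous_on UNIV \<phi> \<and> bounded (range \<phi>) \<and> open U}"

definition mass_le :: "real \<Rightarrow> 'a::euclidean_space measure set" where
  "mass_le C = {\<mu> \<in> finite_measures. measure \<mu> UNIV \<le> C}"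

text \<open>The measure \<open>\<mu> + \<epsilon> \<delta>\<^sub>x\<close> (intended for \<open>\<epsilon> \<ge> 0\<close>).\<close>

definition add_dirac :: "'a::euclidean_space measure \<Rightarrow> real \<Rightarrow> 'a \<Rightarrow> 'a measure" where
  "add_dirac \<mu> \<epsilon> x =
     measure_of UNIV (sets borel) (\<lambda>A. emeasure \<mu> A + ennreal \<epsilon> * emeasure (return borel x) A)"

lemma topspace_weak_topology: "topspace weak_topology = finite_measures"
proof -
  have "finite_measures \<in> {{\<mu> \<in> finite_measures. (\<integral>x. \<phi> x \<partial>\<mu>) \<in> U} | (\<phi> :: 'a \<Rightarrow> real) U.
      continuous_on UNIV \<phi> \<and> bounded (range \<phi>) \<and> open U}"
    by (rule CollectI, rule exI[of _ "\<lambda>_. 0"], rule exI[of _ UNIV]) auto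
  then show ?thesis
    unfolding weak_topology_def topology_generated_by_topspace by blast
qed

lemma sets_add_dirac [simp]: "sets (add_dirac \<mu> \<epsilon> x) = sets borel"
  unfolding add_dirac_def
  by (metis sets.sigma_sets_eq sets.space_closed sets_measure_of space_borel)

lemma emeasure_add_dirac:
  assumes "\<mu> \<in> finite_measures" "A \<in> sets borel"
  shows "emeasure (add_dirac \<mu> \<epsilon> x) A = emeasure \<mu> A + ennreal \<epsilon> * indicator A x"
proof -
  have s: "sets \<mu> = sets borel"
    using assms(1) by (simp add: finite_measures_def)
  have "countably_additive (sets borel)
      (\<lambda>A. emeasure \<mu> A + ennreal \<epsilon> * emeasure (return borel x) A)"
    unfolding countably_additive_def
    by (auto simp: suminf_add[symmetric] suminf_emeasure s simp del: emeasure_return)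
  then have "emeasure (add_dirac \<mu> \<epsilon> x) A = emeasure \<mu> A + ennreal \<epsilon> * emeasure (return borel x) A"
    unfolding add_dirac_def using assms(2)
    by (intro emeasure_measure_of_sigma)
       (auto simp: positive_def sets.sigma_algebra_axioms[of borel, simplified])
  then show ?thesis
    using assms(2) by simp
qed

lemma add_dirac_in_finite_measures:
  assumes "\<mu> \<in> finite_measures"
  shows "add_dirac \<mu> \<epsilon> x \<in> finite_measures"
proof -
  have "space (add_dirac \<mu> \<epsilon> x) = UNIV"
    using sets_eq_imp_space_eq[OF sets_add_dirac] by simp
  moreover have "emeasure \<mu> UNIV \<noteq> \<infinity>"
    using assms sets_eq_imp_space_eq[of \<mu> borel]
    by (auto simp: finite_measures_def finite_measure.finite_emeasure_space finite_measure.emeasure_finite)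
  ultimately have "finite_measure (add_dirac \<mu> \<epsilon> x)"
    by (intro finite_measureI) (simp add: emeasure_add_dirac[OF assms] ennreal_mult_eq_top_iff)
  then show ?thesis
    by (simp add: finite_measures_def)
qed

section \<open>The spaces \<open>C\<^sup>m\<close> on a Euclidean space\<close>

text \<open>Iterated partial derivatives; a list of basis vectors plays the role of a multi-index.\<close>

primrec partials :: "'a::euclidean_space list \<Rightarrow> ('a \<Rightarrow> real) \<Rightarrow> 'a \<Rightarrow> real" where
  "partials [] f = f"
| "partials (b # bs) f = (\<lambda>x. frechet_derivative (partials bs f) (at x) b)"

definition directions :: "nat \<Rightarrow> 'a::euclidean_space list set" where
  "directions m = {bs. set bs \<subseteq> Basis \<and> length bs \<le> m}"

definition C_space :: "nat \<Rightarrow> ('a::euclidean_space \<Rightarrow> real) set" where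
  "C_space m = {f.
     (\<forall>bs \<in> directions m. length bs < m \<longrightarrow> partials bs f differentiable_on UNIV) \<and>
     (\<forall>bs \<in> directions m. continuous_on UNIV (partials bs f))}"

definition C_tendsto :: "nat \<Rightarrow> (nat \<Rightarrow> 'a::euclidean_space \<Rightarrow> real) \<Rightarrow> ('a \<Rightarrow> real) \<Rightarrow> bool" where
  "C_tendsto m f g \<longleftrightarrow> (\<forall>n. f n \<in> C_space m) \<and> g \<in> C_space m \<and>
     (\<forall>bs \<in> directions m. \<forall>K. compact K \<longrightarrow>
        uniform_limit K (\<lambda>n. partials bs (f n)) (partials bs g) sequentially)"

section \<open>Differentiable functions of measures\<close>

text \<open>Functions on the space of finite measures are represented by functions on the whole type of
  measures, whose values outside \<^term>\<open>finite_measures\<close> are irrelevant.\<close>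

definition deriv1_exists ::
  "('a::euclidean_space measure \<Rightarrow> real) \<Rightarrow> 'a measure \<Rightarrow> 'a \<Rightarrow> bool" where
  "deriv1_exists F \<mu> x \<longleftrightarrow>
     (\<exists>l. ((\<lambda>\<epsilon>. (F (add_dirac \<mu> \<epsilon> x) - F \<mu>) / \<epsilon>) \<longlongrightarrow> l) (at_right 0))"

definition deriv1 :: "('a::euclidean_space measure \<Rightarrow> real) \<Rightarrow> 'a measure \<Rightarrow> 'a \<Rightarrow> real" where
  "deriv1 F \<mu> x = Lim (at_right 0) (\<lambda>\<epsilon>. (F (add_dirac \<mu> \<epsilon> x) - F \<mu>) / \<epsilon>)"

text \<open>The mixed derivative \<open>\<partial>\<^sup>2/\<partial>\<epsilon>\<^sub>1\<partial>\<epsilon>\<^sub>2\<close> of \<open>F (\<mu> + \<epsilon>\<^sub>1 \<delta>\<^sub>x + \<epsilon>\<^sub>2 \<delta>\<^sub>y)\<close> at the origin is an iterated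
  one-sided derivative: the inner one, at \<open>\<epsilon>\<^sub>2 = 0\<close>, is
  \<open>deriv1 F (\<mu> + \<epsilon>\<^sub>1 \<delta>\<^sub>x) y\<close>. Existence of the latter is not part of \<open>deriv2_exists\<close>; it is only
  used for functions whose first derivative exists everywhere.\<close>

definition deriv2_exists ::
  "('a::euclidean_space measure \<Rightarrow> real) \<Rightarrow> 'a measure \<Rightarrow> 'a \<Rightarrow> 'a \<Rightarrow> bool" where
  "deriv2_exists F \<mu> x y \<longleftrightarrow> deriv1_exists (\<lambda>\<nu>. deriv1 F \<nu> y) \<mu> x"

definition deriv2 ::
  "('a::euclidean_space measure \<Rightarrow> real) \<Rightarrow> 'a measure \<Rightarrow> 'a \<times> 'a \<Rightarrow> real" where
  "deriv2 F \<mu> = (\<lambda>(x, y). deriv1 (\<lambda>\<nu>. deriv1 F \<nu> y) \<mu> x)"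

definition C_measures :: "nat \<Rightarrow> nat \<Rightarrow> ('a::euclidean_space measure \<Rightarrow> real) set" where
  "C_measures k m = {F.
     continuous_map weak_topology euclideanreal F \<and>
     (k \<ge> 1 \<longrightarrow>
        (\<forall>\<mu> \<in> finite_measures. \<forall>x. deriv1_exists F \<mu> x) \<and>
        (\<forall>\<mu> \<in> finite_measures. deriv1 F \<mu> \<in> C_space m) \<and>
        (\<forall>bs \<in> directions m. continuous_map (prod_topology weak_topology euclidean) euclideanreal
           (\<lambda>(\<mu>, x). partials bs (deriv1 F \<mu>) x))) \<and>
     (k \<ge> 2 \<longrightarrow>
        (\<forall>\<mu> \<in> finite_measures. \<forall>x y. deriv2_exists F \<mu> x y) \<and>
        (\<forall>\<mu> \<in> finite_measures. deriv2 F \<mu> \<in> C_space m) \<and>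
        (\<forall>bs \<in> directions m. continuous_map (prod_topology weak_topology euclidean) euclideanreal
           (\<lambda>(\<mu>, z). partials bs (deriv2 F \<mu>) z)))}"

section \<open>Functions of finitely many integrals\<close>

text \<open>As the dimension \<open>p\<close> is existentially quantified, the space of \<open>p\<close>-tuples is
  \<^term>\<open>Euclidean_space p\<close>: sequences of reals vanishing from index \<open>p\<close> on.\<close>

definition orthant :: "nat \<Rightarrow> (nat \<Rightarrow> real) topology" where
  "orthant p = subtopology (Euclidean_space p) {x. \<forall>i<p. 0 \<le> x i}"

definition orthant_interior :: "nat \<Rightarrow> (nat \<Rightarrow> real) set" where
  "orthant_interior p = {x \<in> topspace (Euclidean_space p). \<forall>i<p. 0 < x i}"

primrec coord_partials :: "nat list \<Rightarrow> ((nat \<Rightarrow> real) \<Rightarrow> real) \<Rightarrow> (nat \<Rightarrow> real) \<Rightarrow> real" where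
  "coord_partials [] u = u"
| "coord_partials (i # is) u = (\<lambda>x. deriv (\<lambda>t. coord_partials is u (x(i := t))) (x i))"

text \<open>The continuous extendability of the partial derivatives to the closed orthant includes their
  continuity in the interior.\<close>

definition C_orthant :: "nat \<Rightarrow> nat \<Rightarrow> ((nat \<Rightarrow> real) \<Rightarrow> real) set" where
  "C_orthant p k = {u.
     continuous_map (orthant p) euclideanreal u \<and>
     (\<forall>is. set is \<subseteq> {..<p} \<and> length is < k \<longrightarrow>
        (\<forall>i<p. \<forall>x \<in> orthant_interior p.
           (\<lambda>t. coord_partials is u (x(i := t))) differentiable (at (x i)))) \<and>
     (\<forall>is. set is \<subseteq> {..<p} \<and> length is \<le> k \<longrightarrow>
        (\<exists>v. continuous_map (orthant p) euclideanreal v \<and>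
             (\<forall>x \<in> orthant_interior p. v x = coord_partials is u x)))}"

definition test_functions :: "('a::euclidean_space \<Rightarrow> real) set" where
  "test_functions = {\<phi>. (\<forall>x. 0 \<le> \<phi> x) \<and> (\<forall>m. \<phi> \<in> C_space m) \<and> compact (closure {x. \<phi> x \<noteq> 0})}"

definition C_P :: "nat \<Rightarrow> ('a::euclidean_space measure \<Rightarrow> real) set" where
  "C_P k = {G. \<exists>p \<phi> u. (\<forall>i<p. \<phi> i \<in> test_functions) \<and> u \<in> C_orthant p k \<and>
     (\<forall>\<mu> \<in> finite_measures. G \<mu> = u (\<lambda>i. if i < p then \<integral>x. \<phi> i x \<partial>\<mu> else 0))}"

section \<open>Approximation and boundedness\<close>

definition approximates ::
  "nat \<Rightarrow> nat \<Rightarrow> (nat \<Rightarrow> 'a::euclidean_space measure \<Rightarrow> real) \<Rightarrow> ('a measure \<Rightarrow> real) \<Rightarrow> bool" where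
  "approximates k m Fn F \<longleftrightarrow>
     (\<forall>\<mu> \<in> finite_measures.
        (\<lambda>n. Fn n \<mu>) \<longlonglongrightarrow> F \<mu> \<and>
        (k \<ge> 1 \<longrightarrow> (\<forall>n x. deriv1_exists (Fn n) \<mu> x) \<and>
           C_tendsto m (\<lambda>n. deriv1 (Fn n) \<mu>) (deriv1 F \<mu>)) \<and>
        (k = 2 \<longrightarrow> (\<forall>n x y. deriv2_exists (Fn n) \<mu> x y) \<and>
           C_tendsto m (\<lambda>n. deriv2 (Fn n) \<mu>) (deriv2 F \<mu>)))"

text \<open>Boundedness on measures of mass at most \<open>C\<close>, uniformly over the family \<open>\<F>\<close>, of the functions,
  their first (if \<open>k \<ge> 1\<close>) and second (if \<open>k = 2\<close>) derivatives, and the space derivatives of the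
  latter two up to order \<open>m\<close>.\<close>

definition bounded_family ::
  "nat \<Rightarrow> nat \<Rightarrow> real \<Rightarrow> ('a::euclidean_space measure \<Rightarrow> real) set \<Rightarrow> bool" where
  "bounded_family k m C \<F> \<longleftrightarrow>
     bounded {F \<mu> | F \<mu>. F \<in> \<F> \<and> \<mu> \<in> mass_le C} \<and>
     (k \<ge> 1 \<longrightarrow> (\<forall>bs \<in> directions m.
        bounded {partials bs (deriv1 F \<mu>) x | F \<mu> x. F \<in> \<F> \<and> \<mu> \<in> mass_le C})) \<and>
     (k = 2 \<longrightarrow> (\<forall>bs \<in> directions m.
        bounded {partials bs (deriv2 F \<mu>) z | F \<mu> z. F \<in> \<F> \<and> \<mu> \<in> mass_le C}))"

end

theory Submission
  imports Defs
begin

text \<open>The approximation is \<open>F\<^sub>n = F \<circ> \<pi>\<^sub>n\<close>, where \<open>\<pi>\<^sub>n\<close> replaces a measure by one carried by the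
points of a finite grid: \<open>\<pi>\<^sub>n \<mu> = \<Sum>\<^sub>z \<langle>w\<^sub>z, \<mu>\<rangle> \<delta>\<^sub>h\<^sub>z\<close> with mesh \<open>h = 1 / (n + 1)\<close>, where \<open>z\<close> runs
through points with integer coordinates and the \<open>w\<^sub>z \<ge> 0\<close> are test functions with
\<open>\<Sum>\<^sub>z w\<^sub>z \<le> 1\<close> (\<open>project\<close>, \<open>weight\<close>). Then \<open>F\<^sub>n(\<mu>)\<close> depends only on the finitely many integrals
\<open>\<langle>w\<^sub>z, \<mu>\<rangle>\<close>, the mass of \<open>\<pi>\<^sub>n \<mu>\<close> is at most that of \<open>\<mu>\<close>, and \<open>\<pi>\<^sub>n \<mu> \<rightarrow> \<mu>\<close> weakly, so
\<open>F\<^sub>n(\<mu>) \<rightarrow> F(\<mu>)\<close> by continuity alone.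

Write \<open>S\<^sub>h g = \<Sum>\<^sub>z w\<^sub>z g(hz)\<close> (\<open>discretize\<close>). As \<open>\<pi>\<^sub>n(\<mu> + \<epsilon>\<delta>\<^sub>x) = \<pi>\<^sub>n \<mu> + \<epsilon> \<Sum>\<^sub>z w\<^sub>z(x) \<delta>\<^sub>h\<^sub>z\<close>, the
chain rule (\<open>chain_rule_add_atoms\<close>) gives \<open>F\<^sub>n'(\<mu>; \<cdot>) = S\<^sub>h (F'(\<pi>\<^sub>n \<mu>; \<cdot>))\<close>, and, because the weights on
\<open>\<real>\<^sup>2\<^sup>d\<close> are products of those on \<open>\<real>\<^sup>d\<close>, also \<open>F\<^sub>n''(\<mu>; \<cdot>) = S\<^sub>h (F''(\<pi>\<^sub>n \<mu>; \<cdot>))\<close>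
(\<open>deriv1_project\<close>, \<open>deriv2_project\<close>). So everything reduces to the operator \<open>S\<^sub>h\<close> on
functions on a Euclidean space: it has to converge to the identity in \<open>C\<^sup>m\<close>, along with its
argument, and to be bounded on functions with bounded derivatives up to order \<open>m\<close>.

For an arbitrary smooth partition of unity the derivatives of \<open>S\<^sub>h g\<close> need not converge. The
weights used here are tensor products of smooth cardinal splines \<open>\<beta>\<^sub>m\<close>, scaled to
the grid. They satisfy \<open>\<beta>\<^sub>s\<^sub>+\<^sub>1'(t) = \<beta>\<^sub>s(t) - \<beta>\<^sub>s(t - 1)\<close>, so summation by parts turns a partial
derivative of the sum over the grid into the sum, with splines of lower order, of difference
quotients of \<open>g\<close> (\<open>partials_quasi\<close>). By the mean value theorem these are
partial derivatives of \<open>g\<close> at points within a distance proportional to \<open>h\<close>, and \<open>S\<^sub>h\<close> takes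
weighted means of such values (\<open>partials_quasi_approx\<close>). The approximation at a point thus
uses only the behaviour of \<open>g\<close> near that point, which is what joint continuity of \<open>F'\<close> and
\<open>F''\<close> controls when \<open>\<mu>\<close> is replaced by \<open>\<pi>\<^sub>n \<mu>\<close>.

To have finitely many nodes, \<open>w\<^sub>z\<close> contains the factor \<open>\<chi>(h\<^sup>2z)\<close> with a smooth cutoff \<open>\<chi>\<close>, which
means that \<open>g\<close> is first multiplied by \<open>x \<mapsto> \<chi>(hx)\<close>. A sharp truncation would make the difference
quotients at its boundary as large as \<open>1 / h\<close>; the derivatives of the smooth factor are bounded
uniformly in \<open>h\<close>, which yields the uniform bounds (\<open>partials_discretize_bound\<close>).

Finally \<open>F\<^sub>n\<close> must be a \<open>C\<^sup>k\<close> function of the integrals although \<open>F\<close> has one-sided derivatives only.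
A continuous function whose right derivative is continuous is continuously differentiable
(\<open>has_real_derivative_if_right_derivative\<close>); applied along the half-lines \<open>t \<mapsto> \<mu> + t\<delta>\<^sub>x\<close>, this gives
both the chain rule and the smoothness on the orthant (\<open>C_orthant_atomic\<close>).\<close>

section \<open>Calculus in the spaces of continuously differentiable functions\<close>

abbreviation partial :: "'a::euclidean_space \<Rightarrow> ('a \<Rightarrow> real) \<Rightarrow> 'a \<Rightarrow> real" where
  "partial b f \<equiv> (\<lambda>x. frechet_derivative f (at x) b)"

text \<open>In \<^term>\<open>partials\<close> the last direction of the list is differentiated first. This makes induction
from the right end of the list an induction on the order of differentiability, as in
\<open>C_space_Suc\<close>.\<close>

lemma partials_snoc: "partials (bs @ [b]) f = partials bs (partial b f)"
  by (induction bs) auto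

lemma C_space_0: "f \<in> C_space 0 \<longleftrightarrow> continuous_on UNIV f"
  by (auto simp: C_space_def directions_def)

lemma C_spaceD:
  assumes "f \<in> C_space m" "bs \<in> directions m"
  shows "continuous_on UNIV (partials bs f)"
    and "length bs < m \<Longrightarrow> partials bs f differentiable (at x)"
  using assms by (auto simp: C_space_def differentiable_on_def)

lemma C_space_Suc:
  "f \<in> C_space (Suc m) \<longleftrightarrow> f differentiable_on UNIV \<and> (\<forall>b\<in>Basis. partial b f \<in> C_space m)"
proof
  assume f: "f \<in> C_space (Suc m)"
  have "[] \<in> directions (Suc m)" by (simp add: directions_def)
  then have "f differentiable_on UNIV"
    using f by (force simp: C_space_def)
  moreover have "partial b f \<in> C_space m" if "b \<in> Basis" for b
  proof -
    have "bs @ [b] \<in> directions (Suc m)" if "bs \<in> directions m" for bs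
      using that \<open>b \<in> Basis\<close> by (auto simp: directions_def)
    then show ?thesis using f unfolding C_space_def
      by (force simp: partials_snoc[symmetric] simp del: partials.simps)
  qed
  ultimately show "f differentiable_on UNIV \<and> (\<forall>b\<in>Basis. partial b f \<in> C_space m)" by blast
next
  assume f: "f differentiable_on UNIV \<and> (\<forall>b\<in>Basis. partial b f \<in> C_space m)"
  have "continuous_on UNIV (partials bs f) \<and>
      (length bs < Suc m \<longrightarrow> partials bs f differentiable_on UNIV)"
    if "bs \<in> directions (Suc m)" for bs
  proof (cases bs rule: rev_cases)
    case Nil
    then show ?thesis using f by (auto intro: differentiable_imp_continuous_on)
  next
    case (snoc cs b)
    then have "cs \<in> directions m" "b \<in> Basis" using that by (auto simp: directions_def)
    then show ?thesis using f by (auto simp: C_space_def partials_snoc snoc)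
  qed
  then show "f \<in> C_space (Suc m)" by (auto simp: C_space_def)
qed

lemma C_space_mono: "f \<in> C_space m \<Longrightarrow> l \<le> m \<Longrightarrow> f \<in> C_space l"
  by (auto simp: C_space_def directions_def)

lemma directions_Cons:
  "b # bs \<in> directions m \<longleftrightarrow> b \<in> Basis \<and> bs \<in> directions m \<and> length bs < m"
  by (auto simp: directions_def)

lemma Nil_in_directions [simp]: "[] \<in> directions m"
  by (simp add: directions_def)

lemma partial_eqI: "(f has_derivative f') (at x) \<Longrightarrow> frechet_derivative f (at x) b = f' b"
  by (metis frechet_derivative_at)

lemma has_partial: "f differentiable (at x) \<Longrightarrow> (f has_derivative frechet_derivative f (at x)) (at x)"
  by (simp add: frechet_derivative_works)

lemma partials_lincomb:
  assumes "f \<in> C_space m" "g \<in> C_space m" "bs \<in> directions m"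
  shows "partials bs (\<lambda>x. a * f x + c * g x) = (\<lambda>x. a * partials bs f x + c * partials bs g x)"
  using assms(3)
proof (induction bs)
  case (Cons b bs)
  then have bs: "bs \<in> directions m" "length bs < m" by (auto simp: directions_Cons)
  note d = C_spaceD(2)[OF assms(1) bs, THEN has_partial] C_spaceD(2)[OF assms(2) bs, THEN has_partial]
  have "((\<lambda>x. a * partials bs f x + c * partials bs g x) has_derivative
      (\<lambda>v. a * frechet_derivative (partials bs f) (at x) v + c * frechet_derivative (partials bs g) (at x) v)) (at x)"
    for x by (intro derivative_intros d)
  from partial_eqI[OF this] show ?case unfolding partials.simps Cons.IH[OF bs(1)] by simp
qed simp

lemma C_space_lincomb:
  assumes "f \<in> C_space m" "g \<in> C_space m"
  shows "(\<lambda>x. a * f x + c * g x) \<in> C_space m"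
  unfolding C_space_def
  using C_spaceD[OF assms(1)] C_spaceD[OF assms(2)]
  by (auto simp: partials_lincomb[OF assms] differentiable_on_def intro!: continuous_intros derivative_intros)

lemma partials_affine:
  assumes "f \<in> C_space m" "bs \<in> directions m"
  shows "partials bs (\<lambda>x. f (c *\<^sub>R x - v)) = (\<lambda>x. c ^ length bs * partials bs f (c *\<^sub>R x - v))"
  using assms(2)
proof (induction bs)
  case (Cons b bs)
  then have bs: "bs \<in> directions m" "length bs < m" by (auto simp: directions_Cons)
  have D: "((\<lambda>x. c ^ length bs * partials bs f (c *\<^sub>R x - v)) has_derivative
      (\<lambda>w. c ^ length bs * frechet_derivative (partials bs f) (at (c *\<^sub>R x - v)) (c *\<^sub>R w))) (at x)" for x
    by (rule derivative_eq_intros has_derivative_compose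
        [OF _ has_partial[OF C_spaceD(2)[OF assms(1) bs]], of "\<lambda>x. c *\<^sub>R x - v"] refl)+ auto
  have "frechet_derivative (partials bs f) (at y) (c *\<^sub>R b) = c * frechet_derivative (partials bs f) (at y) b" for y
    using linear_frechet_derivative[OF C_spaceD(2)[OF assms(1) bs]] by (simp add: linear_cmul)
  then show ?case unfolding partials.simps Cons.IH[OF bs(1)] partial_eqI[OF D]
    by (simp add: mult_ac)
qed simp

lemma C_space_affine:
  assumes "f \<in> C_space m"
  shows "(\<lambda>x. f (c *\<^sub>R x - v)) \<in> C_space m"
proof -
  have "continuous_on UNIV (\<lambda>x. c ^ length bs * partials bs f (c *\<^sub>R x - v))" if "bs \<in> directions m" for bs
    by (intro continuous_intros continuous_on_compose2[OF C_spaceD(1)[OF assms that]]) auto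
  moreover have "(\<lambda>x. c ^ length bs * partials bs f (c *\<^sub>R x - v)) differentiable_on UNIV"
    if "bs \<in> directions m" "length bs < m" for bs
    unfolding differentiable_on_def
    by (auto intro!: derivative_intros differentiable_compose[of "partials bs f"] C_spaceD(2)[OF assms that])
  ultimately show ?thesis
    unfolding C_space_def by (auto simp: partials_affine[OF assms])
qed

lemma C_space_const: "(\<lambda>_. c) \<in> C_space m"
proof (induction m arbitrary: c)
  case (Suc m)
  have "frechet_derivative (\<lambda>_. c) (at x) b = 0" for x b :: 'a by simp
  then show ?case using Suc by (simp add: C_space_Suc)
qed (simp add: C_space_0)

lemma C_space_sum:
  assumes "\<And>i. i \<in> A \<Longrightarrow> f i \<in> C_space m"
  shows "(\<lambda>x. \<Sum>i\<in>A. f i x) \<in> C_space m"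
  using assms
proof (induction A rule: infinite_finite_induct)
  case (insert i A)
  then show ?case using C_space_lincomb[of "f i" m "\<lambda>x. \<Sum>i\<in>A. f i x" 1 1] by auto
qed (auto simp: C_space_const)

lemma partial_mult:
  fixes f g :: "'a::euclidean_space \<Rightarrow> real"
  assumes "f differentiable (at x)" "g differentiable (at x)"
  shows "partial b (\<lambda>x. f x * g x) x = 1 * (partial b f x * g x) + 1 * (f x * partial b g x)"
  using has_derivative_mult[OF assms[THEN has_partial]]
  by (subst partial_eqI) (auto simp: algebra_simps)

lemma C_space_mult:
  assumes "f \<in> C_space m" "g \<in> C_space m"
  shows "(\<lambda>x. f x * g x) \<in> C_space m"
  using assms
proof (induction m arbitrary: f g)
  case 0
  then show ?case by (auto simp: C_space_0 intro: continuous_intros)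
next
  case (Suc m)
  then have d: "f differentiable (at x)" "g differentiable (at x)" for x
    by (auto simp: C_space_Suc differentiable_on_def)
  have "(\<lambda>x. 1 * (partial b f x * g x) + 1 * (f x * partial b g x)) \<in> C_space m" if "b \<in> Basis" for b
    using Suc that by (intro C_space_lincomb Suc.IH) (auto simp: C_space_Suc intro: C_space_mono[of _ "Suc m"])
  then show ?case using d
    by (auto simp: C_space_Suc differentiable_on_def partial_mult)
qed

text \<open>The Leibniz rule has \<open>2 ^ length bs\<close> summands, each bounded by \<open>M * N\<close>. The bound is
pointwise, so the factors may be unbounded elsewhere.\<close>

lemma partials_mult_le:
  assumes "f \<in> C_space m" "g \<in> C_space m" "bs \<in> directions m"
    and "\<And>cs. cs \<in> directions m \<Longrightarrow> \<bar>partials cs f x\<bar> \<le> M"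
    and "\<And>cs. cs \<in> directions m \<Longrightarrow> \<bar>partials cs g x\<bar> \<le> N"
  shows "\<bar>partials bs (\<lambda>x. f x * g x) x\<bar> \<le> 2 ^ length bs * (M * N)"
  using assms
proof (induction m arbitrary: f g bs)
  case 0
  then show ?case by (fastforce simp: directions_def abs_mult intro: mult_mono)
next
  case (Suc m)
  show ?case
  proof (cases bs rule: rev_cases)
    case Nil
    have "\<bar>f x\<bar> \<le> M" "\<bar>g x\<bar> \<le> N" using Suc.prems(4,5)[of "[]"] by auto
    then show ?thesis using Nil by (simp add: abs_mult mult_mono')
  next
    case (snoc cs b)
    then have cs: "cs \<in> directions m" "b \<in> Basis" using Suc.prems(3) by (auto simp: directions_def)
    have d: "f differentiable (at x)" "g differentiable (at x)" for x
      using Suc.prems by (auto simp: C_space_Suc differentiable_on_def)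
    have C: "f \<in> C_space m" "g \<in> C_space m" "partial b f \<in> C_space m" "partial b g \<in> C_space m"
      using Suc.prems cs by (auto simp: C_space_Suc intro: C_space_mono[of _ "Suc m"])
    have e: "ds \<in> directions (Suc m)" "ds @ [b] \<in> directions (Suc m)" if "ds \<in> directions m" for ds
      using that cs by (auto simp: directions_def)
    have 1: "\<bar>partials cs (\<lambda>x. partial b f x * g x) x\<bar> \<le> 2 ^ length cs * (M * N)"
      using Suc.prems(4)[OF e(2)] Suc.prems(5)[OF e(1)]
      by (intro Suc.IH C cs) (auto simp: partials_snoc)
    have 2: "\<bar>partials cs (\<lambda>x. f x * partial b g x) x\<bar> \<le> 2 ^ length cs * (M * N)"
      using Suc.prems(4)[OF e(1)] Suc.prems(5)[OF e(2)]
      by (intro Suc.IH C cs) (auto simp: partials_snoc)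
    have "partials bs (\<lambda>x. f x * g x)
        = partials cs (\<lambda>x. 1 * (partial b f x * g x) + 1 * (f x * partial b g x))"
      using d by (simp only: snoc partials_snoc partial_mult)
    also have "\<dots> = (\<lambda>x. 1 * partials cs (\<lambda>x. partial b f x * g x) x + 1 * partials cs (\<lambda>x. f x * partial b g x) x)"
      by (rule partials_lincomb[OF C_space_mult[OF C(3,2)] C_space_mult[OF C(1,4)] cs(1)])
    finally show ?thesis using 1 2 snoc by simp
  qed
qed

lemma partials_cong_open:
  assumes "open U" "\<And>x. x \<in> U \<Longrightarrow> f x = g x" "x \<in> U"
  shows "partials bs f x = partials bs g x"
  using assms(3)
proof (induction bs arbitrary: x)
  case (Cons b bs)
  have "(partials bs f has_derivative D) (at x) \<longleftrightarrow> (partials bs g has_derivative D) (at x)" for D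
    using Cons assms(1) has_derivative_transform_within_open[of "partials bs f" D x UNIV U "partials bs g"]
     has_derivative_transform_within_open[of "partials bs g" D x UNIV U "partials bs f"] by auto
  then show ?case by (simp add: frechet_derivative_def)
qed (simp add: assms(2))

section \<open>Smooth cardinal splines\<close>

definition smooth :: "('a::euclidean_space \<Rightarrow> real) \<Rightarrow> bool" where
  "smooth f \<longleftrightarrow> (\<forall>m. f \<in> C_space m)"

lemma smooth_affine: "smooth f \<Longrightarrow> smooth (\<lambda>x. f (c *\<^sub>R x - v))"
  by (simp add: smooth_def C_space_affine)

lemma smooth_mult: "smooth f \<Longrightarrow> smooth g \<Longrightarrow> smooth (\<lambda>x. f x * g x)"
  by (simp add: smooth_def C_space_mult)

lemma smooth_lincomb: "smooth f \<Longrightarrow> smooth g \<Longrightarrow> smooth (\<lambda>x. a * f x + c * g x)"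
  by (simp add: smooth_def C_space_lincomb)

lemma smooth_imp_differentiable: "smooth f \<Longrightarrow> f differentiable (at x)"
  by (metis C_space_Suc UNIV_I differentiable_on_def smooth_def)

lemma smooth_imp_continuous: "smooth f \<Longrightarrow> continuous_on S f"
  using smooth_imp_differentiable[THEN differentiable_imp_continuous_within]
  by (meson continuous_at_imp_continuous_on)

lemma C_space_Suc_real:
  fixes f :: "real \<Rightarrow> real"
  assumes "\<And>t. (f has_real_derivative f' t) (at t)"
  shows "f \<in> C_space (Suc m) \<longleftrightarrow> f' \<in> C_space m"
proof -
  have "partial 1 f = f'"
    using partial_eqI[OF assms[unfolded has_field_derivative_def]] by auto
  moreover have "f differentiable_on UNIV"
    using assms by (metis differentiable_at_imp_differentiable_on real_differentiable_def)
  ultimately show ?thesis by (simp add: C_space_Suc)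
qed

lemma smooth_realI:
  fixes f :: "real \<Rightarrow> real"
  assumes "\<And>t. (f has_real_derivative f' t) (at t)" "smooth f'"
  shows "smooth f"
  using C_space_Suc_real[of f f'] assms unfolding smooth_def
  by (metis C_space_mono le_add2 plus_1_eq_Suc)

lemma smooth_realE:
  fixes f :: "real \<Rightarrow> real"
  assumes "smooth f"
  obtains f' where "\<And>t. (f has_real_derivative f' t) (at t)" "smooth f'"
proof -
  have "(f has_real_derivative deriv f t) (at t)" for t
    using smooth_imp_differentiable[OF assms] by (simp add: DERIV_deriv_iff_real_differentiable)
  then show thesis
    using that C_space_Suc_real[of f "deriv f"] assms by (auto simp: smooth_def)
qed

text \<open>The functions \<open>t \<mapsto> p(1/t) exp(-1/t)\<close>, extended by zero to \<open>t \<le> 0\<close>. With all polynomials \<open>p\<close>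
admitted, the family is closed under differentiation.\<close>

definition flat :: "real poly \<Rightarrow> real \<Rightarrow> real" where
  "flat p t = (if t > 0 then poly p (1 / t) * exp (- (1 / t)) else 0)"

lemma poly_times_exp_minus: "((\<lambda>x::real. poly p x * exp (- x)) \<longlongrightarrow> 0) at_top"
proof -
  have "((\<lambda>x. \<Sum>i\<le>degree p. coeff p i * (x ^ i / exp x)) \<longlongrightarrow> (\<Sum>i\<le>degree p. coeff p i * 0)) at_top"
    by (intro tendsto_intros tendsto_power_div_exp_0)
  then show ?thesis
    by (simp add: poly_altdef sum_distrib_right exp_minus divide_inverse mult.assoc)
qed

lemma flat_tendsto_0: "(flat p \<longlongrightarrow> 0) (at_right 0)"
proof -
  have "((\<lambda>t. poly p (inverse t) * exp (- inverse t)) \<longlongrightarrow> 0) (at_right (0::real))"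
    using poly_times_exp_minus filterlim_inverse_at_top_right by (rule filterlim_compose)
  moreover have "\<forall>\<^sub>F t in at_right 0. flat p t = poly p (inverse t) * exp (- inverse t)"
    using eventually_at_right_less[of 0] by eventually_elim (auto simp: flat_def inverse_eq_divide)
  ultimately show ?thesis by (simp add: filterlim_cong)
qed

lemma flat_deriv: "(flat p has_real_derivative flat (monom 1 2 * (p - pderiv p)) t) (at t)"
proof -
  consider "t > 0" | "t < 0" | "t = 0" by linarith
  then show ?thesis
  proof cases
    case 1
    have "((\<lambda>t. poly p (1 / t) * exp (- (1 / t))) has_real_derivative
        flat (monom 1 2 * (p - pderiv p)) t) (at t)"
      using 1 by (auto intro!: derivative_eq_intros poly_DERIV[THEN DERIV_chain2]
          simp: flat_def poly_monom field_simps power2_eq_square)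
    then show ?thesis
      by (rule has_field_derivative_transform_within_open[of _ _ _ "{0<..}"]) (auto simp: flat_def 1)
  next
    case 2
    have "((\<lambda>t. 0) has_real_derivative 0) (at t)" by simp
    then have "(flat p has_real_derivative 0) (at t)"
      by (rule has_field_derivative_transform_within_open[of _ _ _ "{..<0}"]) (auto simp: flat_def 2)
    then show ?thesis using 2 by (simp add: flat_def)
  next
    case 3
    have "((\<lambda>y. flat p y / y) \<longlongrightarrow> 0) (at_right 0)"
      by (rule Lim_transform_eventually[OF flat_tendsto_0[of "[:0,1:] * p"]])
         (use eventually_at_right_less[of 0] in \<open>eventually_elim, auto simp: flat_def\<close>)
    moreover have "((\<lambda>y. flat p y / y) \<longlongrightarrow> 0) (at_left 0)"
      by (rule Lim_transform_eventually[OF tendsto_const])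
         (auto simp: eventually_at_filter flat_def)
    ultimately have "((\<lambda>y. flat p y / y) \<longlongrightarrow> 0) (at 0)"
      by (simp add: filterlim_split_at_real)
    then show ?thesis using 3 by (simp add: DERIV_def flat_def)
  qed
qed

lemma smooth_flat: "smooth (flat p)"
proof -
  have "flat p \<in> C_space m" for m
  proof (induction m arbitrary: p)
    case 0
    then show ?case unfolding C_space_0
      using DERIV_isCont[OF flat_deriv] by (auto intro: continuous_at_imp_continuous_on)
  next
    case (Suc m)
    then show ?case using C_space_Suc_real[OF flat_deriv] by blast
  qed
  then show ?thesis by (simp add: smooth_def)
qed

text \<open>As \<open>f\<close> vanishes on the left half-line, integrating from \<open>-1\<close> gives an antiderivative on the
whole line.\<close>

lemma antiderivative:
  fixes f :: "real \<Rightarrow> real"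
  assumes "continuous_on UNIV f" "\<And>t. t \<le> 0 \<Longrightarrow> f t = 0"
  obtains I where "\<And>t. (I has_real_derivative f t) (at t)" "\<And>t. t \<le> 0 \<Longrightarrow> I t = 0"
proof -
  define I where "I t = integral {-1..t} f" for t
  have I0: "I t = 0" if "t \<le> 0" for t
    using integral_cong[of "{-1..t}" f "\<lambda>_. 0"] that assms(2) by (auto simp: I_def)
  have "(I has_real_derivative f t) (at t)" for t
  proof (cases "t < 0")
    case True
    have "((\<lambda>_. 0) has_real_derivative 0) (at t)" by simp
    then have "(I has_real_derivative 0) (at t)"
      by (rule has_field_derivative_transform_within_open[of _ _ _ "{..<0}"]) (auto simp: I0 True)
    then show ?thesis using True assms(2) by simp
  next
    case False
    then have "(I has_real_derivative f t) (at t within {-1..t+1})"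
      unfolding I_def by (intro integral_has_real_derivative continuous_on_subset[OF assms(1)]) auto
    then show ?thesis using False by (subst (asm) at_within_interior) auto
  qed
  then show thesis using I0 that by blast
qed

definition smooth_step :: "nat \<Rightarrow> (real \<Rightarrow> real) \<Rightarrow> bool" where
  "smooth_step r A \<longleftrightarrow> smooth A \<and> mono A \<and> (\<forall>t\<le>0. A t = 0) \<and> (\<forall>t\<ge>real r. A t = 1)"

lemma mono_if_deriv_nonneg:
  fixes f :: "real \<Rightarrow> real"
  assumes "\<And>t. (f has_real_derivative f' t) (at t)" "\<And>t. f' t \<ge> 0"
  shows "mono f"
  using assms by (intro monoI DERIV_nonneg_imp_nondecreasing[of _ _ f]) auto

text \<open>The normalized integral of the bump \<open>exp(-1/t) exp(-1/(1 - t))\<close> on the unit interval.\<close>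

lemma smooth_step_exists: "\<exists>A. smooth_step 1 A"
proof -
  define \<rho> where "\<rho> t = flat 1 t * flat 1 ((-1) *\<^sub>R t - (-1))" for t
  have sm: "smooth \<rho>"
    unfolding \<rho>_def by (intro smooth_mult smooth_affine smooth_flat)
  obtain I where I: "\<And>t. (I has_real_derivative \<rho> t) (at t)" "\<And>t. t \<le> 0 \<Longrightarrow> I t = 0"
    by (rule antiderivative[OF smooth_imp_continuous[OF sm]]) (auto simp: \<rho>_def flat_def)
  have nn: "\<rho> t \<ge> 0" for t by (simp add: \<rho>_def flat_def)
  have "I 0 < I 1"
  proof (rule DERIV_pos_imp_increasing_open[of 0 1 I])
    show "(0::real) < 1" by simp
    show "continuous_on {0..1} I"
      using I(1) by (auto intro!: DERIV_continuous_on intro: DERIV_subset)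
    show "\<exists>y. (I has_real_derivative y) (at x) \<and> 0 < y" if "0 < x" "x < 1" for x
      using I(1)[of x] that by (intro exI[of _ "\<rho> x"]) (auto simp: \<rho>_def flat_def)
  qed
  then have pos: "I 1 > 0" using I(2)[of 0] by simp
  have const: "I t = I 1" if "t \<ge> 1" for t
  proof (cases "t = 1")
    case False
    then have "1 < t" using that by simp
    then obtain z where "1 < z" "z < t" "I t - I 1 = (t - 1) * \<rho> z"
      using MVT2[of 1 t I \<rho>] I(1) by auto
    then show ?thesis by (simp add: \<rho>_def flat_def)
  qed simp
  define A where "A t = I t / I 1" for t
  have dA: "(A has_real_derivative (1 / I 1) * \<rho> t + 0 * \<rho> t) (at t)" for t
    unfolding A_def using I(1)[of t] pos by (auto intro!: derivative_eq_intros)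
  have "smooth A" by (rule smooth_realI[OF dA smooth_lincomb[OF sm sm]])
  moreover have "mono A" using dA by (rule mono_if_deriv_nonneg) (use nn pos in simp)
  moreover have "A t = 1" if "t \<ge> 1" for t
    unfolding A_def const[OF that] using pos by simp
  moreover have "A t = 0" if "t \<le> 0" for t
    using that I(2) by (simp add: A_def)
  ultimately have "smooth_step 1 A"
    by (simp add: smooth_step_def)
  then show ?thesis by blast
qed

text \<open>\<open>B(t)\<close> is the mean of \<open>A\<close> over \<open>[t - 1, t]\<close>. Repeating the construction yields steps of higher and
higher order whose derivatives are differences of the preceding ones.\<close>

lemma smooth_step_average:
  assumes A: "smooth_step r A"
  shows "\<exists>B. smooth_step (Suc r) B \<and> (\<forall>t. (B has_real_derivative A t - A (t - 1)) (at t))"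
proof -
  have sm: "smooth A" using A by (simp add: smooth_step_def)
  obtain I where I: "\<And>t. (I has_real_derivative A t) (at t)" "\<And>t. t \<le> 0 \<Longrightarrow> I t = 0"
    by (rule antiderivative[of A]) (use A smooth_imp_continuous[OF sm] in \<open>auto simp: smooth_step_def\<close>)
  define B where "B t = I t - I (t - 1)" for t
  have dB: "(B has_real_derivative A t - A (t - 1)) (at t)" for t
    unfolding B_def by (auto intro!: derivative_eq_intros I(1)[THEN DERIV_chain2] I(1))
  have "smooth (\<lambda>t. 1 * A t + (-1) * A (1 *\<^sub>R t - 1))"
    by (intro smooth_lincomb smooth_affine sm)
  then have "smooth B" by (intro smooth_realI[OF dB]) simp
  moreover have "A (t - 1) \<le> A t" for t using A by (auto simp: smooth_step_def mono_def)
  then have "mono B" by (intro mono_if_deriv_nonneg[OF dB]) simp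
  moreover have "B t = 1" if "t \<ge> real (Suc r)" for t
  proof -
    obtain z where "t - 1 < z" "I t - I (t - 1) = (t - (t - 1)) * A z"
      using MVT2[of "t - 1" t I A] I(1) by auto
    then show ?thesis using A that by (auto simp: smooth_step_def B_def)
  qed
  ultimately show ?thesis using dB I(2) by (intro exI[of _ B]) (auto simp: smooth_step_def B_def)
qed

definition spline_step :: "nat \<Rightarrow> real \<Rightarrow> real" where
  "spline_step = (SOME A. \<forall>s. smooth_step (Suc s) (A s) \<and>
     (\<forall>t. (A (Suc s) has_real_derivative A s t - A s (t - 1)) (at t)))"

lemma spline_step: "smooth_step (Suc s) (spline_step s)"
    and spline_step_deriv:
      "(spline_step (Suc s) has_real_derivative spline_step s t - spline_step s (t - 1)) (at t)"
proof -
  have "\<exists>A. \<forall>s. smooth_step (Suc s) (A s) \<and>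
     (\<forall>t. (A (Suc s) has_real_derivative A s t - A s (t - 1)) (at t))"
    using smooth_step_exists smooth_step_average
    by (intro dependent_nat_choice[of "\<lambda>s A. smooth_step (Suc s) A"
          "\<lambda>s A B. \<forall>t. (B has_real_derivative A t - A (t - 1)) (at t)"]) auto
  from someI_ex[OF this, folded spline_step_def]
  show "smooth_step (Suc s) (spline_step s)"
    "(spline_step (Suc s) has_real_derivative spline_step s t - spline_step s (t - 1)) (at t)" by auto
qed

text \<open>The cardinal splines, built from a smooth step instead of the Heaviside function, which makes all
of them smooth. As differences of steps their integer translates sum to one by telescoping.\<close>

definition spline :: "nat \<Rightarrow> real \<Rightarrow> real" where
  "spline s t = spline_step s t - spline_step s (t - 1)"

lemma smooth_spline: "smooth (spline s)"
proof -
  have "smooth (\<lambda>t. 1 * spline_step s t + (-1) * spline_step s (1 *\<^sub>R t - 1))"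
    using spline_step by (intro smooth_lincomb smooth_affine) (auto simp: smooth_step_def)
  then show ?thesis by (simp add: spline_def[abs_def])
qed

lemma spline_nonneg: "0 \<le> spline s t"
  using spline_step[of s] by (auto simp: smooth_step_def spline_def mono_def)

lemma spline_eq_0: "t \<le> 0 \<or> t \<ge> real s + 2 \<Longrightarrow> spline s t = 0"
  using spline_step[of s] by (auto simp: smooth_step_def spline_def)

lemma spline_deriv: "(spline (Suc s) has_real_derivative spline s t - spline s (t - 1)) (at t)"
  unfolding spline_def
  by (auto intro!: derivative_eq_intros spline_step_deriv spline_step_deriv[THEN DERIV_chain2] simp: spline_def)

lemma spline_sum:
  assumes "\<bar>t\<bar> + real s + 2 \<le> of_int N"
  shows "(\<Sum>j\<in>{-N..N}. spline s (t - of_int j)) = 1"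
proof -
  have N: "N \<ge> 0" using assms by linarith
  \<comment> \<open>The sum telescopes; at its two ends the step has reached the values one and zero.\<close>
  have "(\<Sum>j\<in>{-N..N}. spline s (t - of_int j))
      = spline_step s (t + of_int N) - spline_step s (t - of_int N - 1)"
  proof -
    have "(\<Sum>j\<in>{-N..-N + int n}. spline s (t - of_int j))
        = spline_step s (t + of_int N) - spline_step s (t + of_int N - of_int n - 1)" for n
    proof (induction n)
      case (Suc n)
      have "{-N..-N + int (Suc n)} = insert (-N + int n + 1) {-N..-N + int n}" by auto
      then show ?case using Suc by (simp add: spline_def algebra_simps)
    qed (simp add: spline_def)
    from this[of "nat (2 * N)"] N show ?thesis by (simp add: algebra_simps)
  qed
  then show ?thesis using spline_step[of s] assms by (auto simp: smooth_step_def)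
qed

definition plateau :: "real \<Rightarrow> real" where
  "plateau t = spline_step 0 (t + 2) - spline_step 0 (t - 1)"

lemma smooth_plateau: "smooth plateau"
proof -
  have "smooth (\<lambda>t. 1 * spline_step 0 (1 *\<^sub>R t - (-2)) + (-1) * spline_step 0 (1 *\<^sub>R t - 1))"
    using spline_step by (intro smooth_lincomb smooth_affine) (auto simp: smooth_step_def)
  then show ?thesis by (simp add: plateau_def[abs_def])
qed

lemma plateau_range: "0 \<le> plateau t" "plateau t \<le> 1"
proof -
  have m: "mono (spline_step 0)" using spline_step[of 0] by (auto simp: smooth_step_def)
  then show "0 \<le> plateau t" by (auto simp: plateau_def mono_def)
  have "spline_step 0 (t + 2) \<le> spline_step 0 (max 1 (t + 2))"
    "spline_step 0 (min 0 (t - 1)) \<le> spline_step 0 (t - 1)" using m by (auto simp: mono_def)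
  then show "plateau t \<le> 1" using spline_step[of 0] by (auto simp: smooth_step_def plateau_def)
qed

lemma plateau_eq_1: "\<bar>t\<bar> \<le> 1 \<Longrightarrow> plateau t = 1"
  using spline_step[of 0] by (auto simp: smooth_step_def plateau_def)

lemma plateau_eq_0:
  assumes "\<bar>t\<bar> \<ge> 2"
  shows "plateau t = 0"
proof -
  have "t \<ge> 2 \<or> t \<le> -2" using assms by linarith
  then show ?thesis using spline_step[of 0] by (auto simp: smooth_step_def plateau_def)
qed

section \<open>Tensor products\<close>

lemma partials_zero: "partials bs (\<lambda>_. 0) = (\<lambda>_. 0)"
  by (induction bs) auto

lemma finite_directions: "finite (directions m :: 'a::euclidean_space list set)"
proof -
  have "directions m = {bs :: 'a list. set bs \<subseteq> Basis \<and> length bs \<le> m}" by (simp add: directions_def)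
  then show ?thesis using finite_lists_length_le[OF finite_Basis] by simp
qed

text \<open>Each partial derivative is continuous and vanishes outside a ball.\<close>

lemma partials_bounded_if_bounded_support:
  fixes f :: "'a::euclidean_space \<Rightarrow> real"
  assumes "smooth f" "bounded {x. f x \<noteq> 0}"
  obtains M where "M \<ge> 0" "\<And>bs x. bs \<in> directions m \<Longrightarrow> \<bar>partials bs f x\<bar> \<le> M"
proof -
  obtain r where r: "\<And>x. f x \<noteq> 0 \<Longrightarrow> norm x \<le> r" using assms(2) by (auto simp: bounded_iff)
  have "\<exists>M\<ge>0. \<forall>x. \<bar>partials bs f x\<bar> \<le> M" if "bs \<in> directions m" for bs
  proof -
    have "continuous_on UNIV (partials bs f)"
      using assms(1) that C_spaceD(1) by (auto simp: smooth_def)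
    then have "compact (partials bs f ` cball 0 r)"
      by (intro compact_continuous_image) (auto intro: continuous_on_subset)
    then obtain M where M: "\<And>x. norm x \<le> r \<Longrightarrow> \<bar>partials bs f x\<bar> \<le> M"
      using compact_imp_bounded by (force simp: bounded_iff)
    have "partials bs f x = 0" if "\<not> norm x \<le> r" for x
    proof -
      have "partials bs f x = partials bs (\<lambda>_. 0) x"
        using that r by (intro partials_cong_open[of "- cball 0 r"]) auto
      then show ?thesis by (simp add: partials_zero)
    qed
    then have "\<bar>partials bs f x\<bar> \<le> max 0 M" for x using M[of x] by (cases "norm x \<le> r") auto
    then show ?thesis by (intro exI[of _ "max 0 M"]) auto
  qed
  then obtain M where M: "\<And>bs. bs \<in> directions m \<Longrightarrow> M bs \<ge> 0"
    "\<And>bs x. bs \<in> directions m \<Longrightarrow> \<bar>partials bs f x\<bar> \<le> M bs" by metis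
  show thesis
  proof (rule that)
    show "0 \<le> sum M (directions m)" using M(1) by (simp add: sum_nonneg)
    show "\<bar>partials bs f x\<bar> \<le> sum M (directions m)" if "bs \<in> directions m" for bs x
    proof -
      have "M bs \<le> sum M (directions m)"
        using that M(1) finite_directions by (intro member_le_sum) auto
      then show ?thesis using M(2)[OF that, of x] by linarith
    qed
  qed
qed


definition tensor :: "('a::euclidean_space \<Rightarrow> real \<Rightarrow> real) \<Rightarrow> 'a \<Rightarrow> real" where
  "tensor u x = (\<Prod>b\<in>Basis. u b (x \<bullet> b))"

lemma tensor_remove:
  assumes "b \<in> Basis"
  shows "tensor u x = u b (x \<bullet> b) * (\<Prod>c\<in>Basis - {b}. u c (x \<bullet> c))"
  using assms by (simp add: tensor_def prod.remove)

lemma partial_tensor: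
  assumes u: "\<And>c. c \<in> Basis \<Longrightarrow> smooth (u c)" and b: "b \<in> Basis"
    and u': "\<And>t. (u b has_real_derivative u' t) (at t)"
  shows "tensor u differentiable (at x)" "partial b (tensor u) x = tensor (u(b := u')) x"
proof -
  have "\<exists>D. \<forall>t. (u c has_real_derivative D t) (at t)" if "c \<in> Basis" for c
    using smooth_realE[OF u[OF that]] by metis
  then obtain D where D: "\<And>c t. c \<in> Basis \<Longrightarrow> (u c has_real_derivative D c t) (at t)" by metis
  have "((\<lambda>x. u c (x \<bullet> c)) has_derivative (\<lambda>v. (v \<bullet> c) * D c (x \<bullet> c))) (at x)" if "c \<in> Basis" for c
    by (rule DERIV_compose_FDERIV[OF D[OF that]]) (auto intro!: derivative_eq_intros)
  then have d: "(tensor u has_derivative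
      (\<lambda>v. \<Sum>c\<in>Basis. (v \<bullet> c) * D c (x \<bullet> c) * (\<Prod>e\<in>Basis - {c}. u e (x \<bullet> e)))) (at x)"
    unfolding tensor_def by (intro has_derivative_prod) 
  then show "tensor u differentiable (at x)" by (auto simp: differentiable_def)
  have "D b t = u' t" for t using DERIV_unique D[OF b] u' by blast
  then have "(\<Sum>c\<in>Basis. (b \<bullet> c) * D c (x \<bullet> c) * (\<Prod>e\<in>Basis - {c}. u e (x \<bullet> e)))
      = u' (x \<bullet> b) * (\<Prod>e\<in>Basis - {b}. u e (x \<bullet> e))"
    using b by (subst sum.remove[of _ b]) (auto simp: inner_Basis split: if_splits intro!: sum.neutral)
  also have "\<dots> = tensor (u(b := u')) x"
    using b by (auto simp: tensor_remove intro!: prod.cong)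
  finally show "partial b (tensor u) x = tensor (u(b := u')) x"
    using partial_eqI[OF d] by simp
qed

lemma smooth_tensor:
  assumes "\<And>b. b \<in> Basis \<Longrightarrow> smooth (u b)"
  shows "smooth (tensor u)"
proof -
  have "tensor u \<in> C_space m" for m
    using assms
  proof (induction m arbitrary: u)
    case 0
    show ?case
      unfolding C_space_0 tensor_def
    proof (intro continuous_on_prod)
      fix b :: 'a assume "b \<in> Basis"
      then show "continuous_on UNIV (\<lambda>x. u b (x \<bullet> b))"
        by (intro continuous_on_compose2[OF smooth_imp_continuous[OF 0, of b UNIV]] continuous_intros) auto
    qed
  next
    case (Suc m)
    have "partial b (tensor u) \<in> C_space m" if b: "b \<in> Basis" for b
    proof -
      obtain u' where u': "\<And>t. (u b has_real_derivative u' t) (at t)" "smooth u'"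
        using smooth_realE[OF Suc.prems[OF b]] by metis
      then have "partial b (tensor u) = tensor (u(b := u'))"
        by (intro ext partial_tensor(2) Suc.prems b) auto
      then show ?thesis using Suc u' by auto
    qed
    moreover have "tensor u differentiable (at x)" for x
    proof -
      obtain b :: 'a where b: "b \<in> Basis" using nonempty_Basis by blast
      obtain u' where u': "\<And>t. (u b has_real_derivative u' t) (at t)"
        using smooth_realE[OF Suc.prems[OF b]] by metis
      then show ?thesis by (intro partial_tensor(1)[where b = b] Suc.prems b) auto
    qed
    ultimately show ?case by (simp add: C_space_Suc differentiable_on_def)
  qed
  then show ?thesis by (simp add: smooth_def)
qed

lemma tensor_pair:
  fixes x :: "'a::euclidean_space" and y :: "'b::euclidean_space"
  shows "tensor (\<lambda>_. w) (x, y) = tensor (\<lambda>_. w) x * tensor (\<lambda>_. w) y"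
proof -
  have "inj_on (\<lambda>u::'a. (u, 0::'b)) Basis" "inj_on (\<lambda>u::'b. (0::'a, u)) Basis"
    by (auto simp: inj_on_def)
  then show ?thesis
    unfolding tensor_def Basis_prod_def
    by (subst prod.union_disjoint) (auto simp: prod.reindex)
qed

definition cutoff :: "'a::euclidean_space \<Rightarrow> real" where
  "cutoff = tensor (\<lambda>_. plateau)"

lemma smooth_cutoff: "smooth cutoff"
  unfolding cutoff_def by (intro smooth_tensor smooth_plateau)

lemma cutoff_range: "0 \<le> cutoff x" "cutoff x \<le> 1"
  unfolding cutoff_def tensor_def using plateau_range by (auto intro: prod_nonneg prod_le_1)

lemma cutoff_eq_1: "norm x \<le> 1 \<Longrightarrow> cutoff x = 1"
  unfolding cutoff_def tensor_def
  by (intro prod.neutral ballI plateau_eq_1) (meson Basis_le_norm order_trans)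

lemma bounded_support_cutoff: "bounded {x. cutoff x \<noteq> (0::real)}"
proof -
  have "\<bar>x \<bullet> b\<bar> \<le> 2" if "cutoff x \<noteq> 0" "b \<in> Basis" for x b :: 'a
    using that plateau_eq_0[of "x \<bullet> b"] by (force simp: cutoff_def tensor_def)
  then have "{x::'a. cutoff x \<noteq> 0} \<subseteq> cbox (-2 *\<^sub>R One) (2 *\<^sub>R One)"
    by (force simp: mem_box abs_le_iff)
  then show ?thesis using bounded_cbox bounded_subset by blast
qed


section \<open>Points with integer coordinates\<close>

definition int_lattice :: "'a::euclidean_space set" where
  "int_lattice = {z. \<forall>b\<in>Basis. z \<bullet> b \<in> \<int>}"

definition lattice_box :: "int \<Rightarrow> 'a::euclidean_space set" where
  "lattice_box N = {z \<in> int_lattice. \<forall>b\<in>Basis. \<bar>z \<bullet> b\<bar> \<le> of_int N}"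

lemma lattice_shift:
  assumes "b \<in> Basis"
  shows "z - b \<in> int_lattice \<longleftrightarrow> z \<in> int_lattice"
proof -
  have 1: "r - 1 \<in> \<int> \<longleftrightarrow> r \<in> \<int>" for r :: real
    by (metis Ints_1 Ints_add Ints_diff diff_add_cancel)
  have "(z - b) \<bullet> c \<in> \<int> \<longleftrightarrow> z \<bullet> c \<in> \<int>" if "c \<in> Basis" for c
    using assms that 1 by (cases "b = c") (auto simp: inner_diff_left inner_Basis)
  then show ?thesis by (simp add: int_lattice_def)
qed

lemma lattice_pair: "(x, y) \<in> int_lattice \<longleftrightarrow> x \<in> int_lattice \<and> y \<in> int_lattice"
  by (force simp: int_lattice_def Basis_prod_def)

text \<open>The box is a product of integer intervals, so a sum of tensor products over it factorizes.\<close>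

lemma sum_lattice_box:
  "(\<Sum>z\<in>lattice_box N. \<Prod>b\<in>Basis. g b (z \<bullet> b))
     = (\<Prod>b\<in>(Basis :: 'a::euclidean_space set). \<Sum>j\<in>{-N..N}. g b (of_int j) :: real)"
  and finite_lattice_box: "finite (lattice_box N :: 'a set)"
proof -
  let ?P = "PiE (Basis :: 'a set) (\<lambda>_. {-N..N})"
  let ?pt = "\<lambda>i::'a \<Rightarrow> int. \<Sum>b\<in>Basis. of_int (i b) *\<^sub>R b"
  have pt: "?pt i \<bullet> b = of_int (i b)" if "b \<in> Basis" for i b
    using that by (simp add: inner_sum_left inner_Basis if_distrib cong: if_cong)
  have co: "bij_betw ?pt ?P (lattice_box N)"
  proof (rule bij_betwI[where g = "\<lambda>z. \<lambda>b\<in>Basis. \<lfloor>z \<bullet> b\<rfloor>"])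
    show "?pt \<in> ?P \<rightarrow> lattice_box N"
      by (force simp: lattice_box_def int_lattice_def pt)
    show "(\<lambda>z. \<lambda>b\<in>Basis. \<lfloor>z \<bullet> b\<rfloor>) \<in> lattice_box N \<rightarrow> ?P"
    proof (intro Pi_I PiE_I)
      fix z b :: 'a assume "z \<in> lattice_box N" "b \<in> Basis"
      then have "z \<bullet> b \<in> \<int>" "\<bar>z \<bullet> b\<bar> \<le> of_int N" by (auto simp: lattice_box_def int_lattice_def)
      then show "(\<lambda>b\<in>Basis. \<lfloor>z \<bullet> b\<rfloor>) b \<in> {-N..N}" using \<open>b \<in> Basis\<close>
        by (auto elim!: Ints_cases)
    qed auto
    show "(\<lambda>b\<in>Basis. \<lfloor>?pt i \<bullet> b\<rfloor>) = i" if "i \<in> ?P" for i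
      using that by (auto simp: pt fun_eq_iff PiE_def extensional_def)
    show "?pt (\<lambda>b\<in>Basis. \<lfloor>z \<bullet> b\<rfloor>) = z" if z: "z \<in> lattice_box N" for z
    proof (rule euclidean_eqI)
      fix b :: 'a assume b: "b \<in> Basis"
      then have "z \<bullet> b \<in> \<int>" using z by (simp add: lattice_box_def int_lattice_def)
      then obtain n where "z \<bullet> b = of_int n" by (rule Ints_cases)
      then show "?pt (\<lambda>b\<in>Basis. \<lfloor>z \<bullet> b\<rfloor>) \<bullet> b = z \<bullet> b"
        unfolding pt[OF b] using b by simp
    qed
  qed
  have fP: "finite ?P" by (intro finite_PiE) auto
  show "finite (lattice_box N :: 'a set)" using bij_betw_finite[OF co] fP by simp
  have "(\<Sum>z\<in>lattice_box N. \<Prod>b\<in>Basis. g b (z \<bullet> b)) = (\<Sum>i\<in>?P. \<Prod>b\<in>Basis. g b (?pt i \<bullet> b))"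
    by (rule sum.reindex_bij_betw[OF co, symmetric])
  also have "\<dots> = (\<Sum>i\<in>?P. \<Prod>b\<in>Basis. g b (of_int (i b)))"
    by (intro sum.cong prod.cong refl) (simp add: pt)
  also have "\<dots> = (\<Prod>b\<in>Basis. \<Sum>j\<in>{-N..N}. g b (of_int j))"
    by (simp add: prod_sum_PiE)
  finally show "(\<Sum>z\<in>lattice_box N. \<Prod>b\<in>Basis. g b (z \<bullet> b))
     = (\<Prod>b\<in>(Basis :: 'a set). \<Sum>j\<in>{-N..N}. g b (of_int j))" .
qed

lemma lattice_boxI:
  assumes "z \<in> int_lattice" "norm z \<le> of_int N"
  shows "z \<in> lattice_box N"
  using assms Basis_le_norm[of _ z] unfolding lattice_box_def by (auto intro: order_trans)

lemma finite_lattice_if_bounded: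
  assumes "bounded S" "h > 0"
  shows "finite {z \<in> int_lattice. h *\<^sub>R z \<in> S}"
proof -
  obtain r where r: "\<And>x. x \<in> S \<Longrightarrow> norm x \<le> r" using assms(1) by (auto simp: bounded_iff)
  have "z \<in> lattice_box \<lceil>r / h\<rceil>" if "z \<in> int_lattice" "h *\<^sub>R z \<in> S" for z
  proof (rule lattice_boxI[OF that(1)])
    have "norm z \<le> r / h" using r[OF that(2)] assms(2) by (simp add: field_simps)
    then show "norm z \<le> of_int \<lceil>r / h\<rceil>" by linarith
  qed
  then have "{z \<in> int_lattice. h *\<^sub>R z \<in> S} \<subseteq> lattice_box \<lceil>r / h\<rceil>" by auto
  then show ?thesis using finite_lattice_box by (rule finite_subset)
qed


section \<open>Quasi-interpolation by splines\<close>

text \<open>The summation is restricted to the support of the values of \<open>f\<close>, since a sum over all of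
\<^term>\<open>int_lattice\<close> would be zero by convention; by \<open>quasi_eq\<close> every larger finite set serves
as well. The orders of the splines may depend on the coordinate, because differentiating in one
direction lowers the order in that direction only.\<close>

definition quasi :: "('a::euclidean_space \<Rightarrow> nat) \<Rightarrow> real \<Rightarrow> ('a \<Rightarrow> real) \<Rightarrow> 'a \<Rightarrow> real" where
  "quasi s h f x = (\<Sum>z \<in> {z \<in> int_lattice. f (h *\<^sub>R z) \<noteq> 0}.
     f (h *\<^sub>R z) * tensor (\<lambda>b. spline (s b)) ((1 / h) *\<^sub>R x - z))"

lemma quasi_eq:
  assumes "finite A" "A \<subseteq> int_lattice" "\<And>z. z \<in> int_lattice \<Longrightarrow> f (h *\<^sub>R z) \<noteq> 0 \<Longrightarrow> z \<in> A"
  shows "quasi s h f x = (\<Sum>z\<in>A. f (h *\<^sub>R z) * tensor (\<lambda>b. spline (s b)) ((1 / h) *\<^sub>R x - z))"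
  unfolding quasi_def using assms by (intro sum.mono_neutral_left) auto

lemma smooth_tensor_spline: "smooth (tensor (\<lambda>b. spline (s b)))"
  by (intro smooth_tensor smooth_spline)

lemma smooth_quasi: "smooth (quasi s h f)"
proof -
  have "(\<lambda>x. f (h *\<^sub>R z) * tensor (\<lambda>b. spline (s b)) ((1 / h) *\<^sub>R x - z)) \<in> C_space m" for m z
    using smooth_tensor_spline[of s]
    by (intro C_space_mult C_space_const C_space_affine) (simp add: smooth_def)
  then show ?thesis unfolding smooth_def quasi_def by (intro allI C_space_sum)
qed

definition bdiff :: "real \<Rightarrow> 'a::euclidean_space \<Rightarrow> ('a \<Rightarrow> real) \<Rightarrow> 'a \<Rightarrow> real" where
  "bdiff h b f y = (f y - f (y - h *\<^sub>R b)) / h"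

primrec bdiffs :: "real \<Rightarrow> 'a::euclidean_space list \<Rightarrow> ('a \<Rightarrow> real) \<Rightarrow> 'a \<Rightarrow> real" where
  "bdiffs h [] f = f"
| "bdiffs h (b # bs) f = bdiff h b (bdiffs h bs f)"

lemma bdiffs_commute: "bdiffs h bs (bdiff h b f) = bdiff h b (bdiffs h bs f)"
proof (induction bs)
  case (Cons c bs)
  have "bdiff h c (bdiff h b g) = bdiff h b (bdiff h c g)" for g :: "'a \<Rightarrow> real"
    by (auto simp: bdiff_def fun_eq_iff diff_divide_distrib algebra_simps)
  then show ?case using Cons by simp
qed simp

lemma bounded_support_bdiff:
  assumes "bounded {x. f x \<noteq> 0}"
  shows "bounded {x. bdiff h b f x \<noteq> 0}"
proof -
  have "{x. bdiff h b f x \<noteq> 0} \<subseteq> {x. f x \<noteq> 0} \<union> (\<lambda>x. h *\<^sub>R b + x) ` {x. f x \<noteq> 0}"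
  proof
    fix x assume "x \<in> {x. bdiff h b f x \<noteq> 0}"
    then have "f x \<noteq> 0 \<or> f (x - h *\<^sub>R b) \<noteq> 0" by (auto simp: bdiff_def)
    then show "x \<in> {x. f x \<noteq> 0} \<union> (\<lambda>x. h *\<^sub>R b + x) ` {x. f x \<noteq> 0}"
      by (auto intro!: image_eqI[of x _ "x - h *\<^sub>R b"])
  qed
  then show ?thesis using assms bounded_translation bounded_subset by (metis bounded_Un)
qed

lemma bounded_support_bdiffs:
  "bounded {x. f x \<noteq> 0} \<Longrightarrow> bounded {x. bdiffs h bs f x \<noteq> 0}"
  by (induction bs) (auto intro: bounded_support_bdiff)

lemma partial_tensor_spline:
  assumes b: "b \<in> Basis" and s: "s b = Suc t"
  shows "partial b (tensor (\<lambda>c. spline (s c))) x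
    = tensor (\<lambda>c. spline ((s(b := t)) c)) x - tensor (\<lambda>c. spline ((s(b := t)) c)) (x - b)"
proof -
  have "partial b (tensor (\<lambda>c. spline (s c))) x
      = tensor ((\<lambda>c. spline (s c))(b := \<lambda>r. spline t r - spline t (r - 1))) x"
    using b s spline_deriv by (intro partial_tensor(2)) (auto intro: smooth_spline)
  also have "\<dots> = tensor (\<lambda>c. spline ((s(b := t)) c)) x - tensor (\<lambda>c. spline ((s(b := t)) c)) (x - b)"
  proof -
    have "(\<Prod>c\<in>Basis - {b}. spline ((s(b := t)) c) ((x - b) \<bullet> c)) = (\<Prod>c\<in>Basis - {b}. spline (s c) (x \<bullet> c))"
      using b by (intro prod.cong) (auto simp: inner_diff_left inner_Basis)
    moreover have "(\<Prod>c\<in>Basis - {b}. spline ((s(b := t)) c) (x \<bullet> c)) = (\<Prod>c\<in>Basis - {b}. spline (s c) (x \<bullet> c))"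
      by (intro prod.cong) auto
    moreover have "(\<Prod>c\<in>Basis - {b}. ((\<lambda>c. spline (s c))(b := \<lambda>r. spline t r - spline t (r - 1))) c (x \<bullet> c))
       = (\<Prod>c\<in>Basis - {b}. spline (s c) (x \<bullet> c))"
      by (intro prod.cong) auto
    ultimately show ?thesis
      using b by (simp add: tensor_remove[OF b] inner_diff_left inner_Basis left_diff_distrib)
  qed
  finally show ?thesis .
qed

text \<open>Summation by parts: the derivative of the spline factor is a difference of two translates by one
node, and shifting the index in one of the two sums moves this difference to \<open>f\<close>.\<close>

lemma partial_quasi:
  assumes h: "h > 0" and f: "bounded {x. f x \<noteq> 0}" and b: "b \<in> Basis" and s: "s b = Suc t"
  shows "partial b (quasi s h f) x = quasi (s(b := t)) h (bdiff h b f) x"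
proof -
  let ?T = "tensor (\<lambda>c. spline (s c))" and ?U = "tensor (\<lambda>c. spline ((s(b := t)) c))"
  define A where "A = {z \<in> int_lattice. f (h *\<^sub>R z) \<noteq> 0}"
  define A' where "A' = (\<lambda>z. z + b) ` A"
  have finA: "finite A"
    using finite_lattice_if_bounded[OF f h] by (simp add: A_def)
  have inA: "A \<subseteq> int_lattice" "A' \<subseteq> int_lattice"
    using lattice_shift[OF b, of "_ + b"] by (auto simp: A_def A'_def)
  \<comment> \<open>\<open>A'\<close> collects the nodes whose predecessor in direction \<open>b\<close> lies in the support.\<close>
  have f': "f (h *\<^sub>R (z - b)) \<noteq> 0 \<longleftrightarrow> z \<in> A'" if "z \<in> int_lattice" for z
    using that lattice_shift[OF b] by (force simp: A_def A'_def image_iff algebra_simps)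
  have d: "((\<lambda>x. ?T ((1 / h) *\<^sub>R x - z)) has_derivative
      (\<lambda>v. frechet_derivative ?T (at ((1 / h) *\<^sub>R x - z)) ((1 / h) *\<^sub>R v))) (at x)" for z
    by (rule has_derivative_compose[OF _ has_partial[OF smooth_imp_differentiable[OF smooth_tensor_spline]],
          of "\<lambda>x. (1 / h) *\<^sub>R x - z"])
       (auto intro!: derivative_eq_intros)
  have lin: "frechet_derivative ?T (at y) ((1 / h) *\<^sub>R b) = (1 / h) * (?U y - ?U (y - b))" for y
    using linear_frechet_derivative[OF smooth_imp_differentiable[OF smooth_tensor_spline[of s]], of y]
    by (simp add: linear_cmul partial_tensor_spline[OF b, of s t, OF s])
  have "partial b (quasi s h f) x
      = (\<Sum>z\<in>A. f (h *\<^sub>R z) * ((1 / h) * (?U ((1 / h) *\<^sub>R x - z) - ?U ((1 / h) *\<^sub>R x - z - b))))"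
    unfolding quasi_def A_def[symmetric]
    by (subst partial_eqI[OF has_derivative_sum[OF has_derivative_mult_right[OF d]]]) (simp add: lin)
  also have "\<dots> = (1 / h) * ((\<Sum>z\<in>A. f (h *\<^sub>R z) * ?U ((1 / h) *\<^sub>R x - z))
      - (\<Sum>z\<in>A. f (h *\<^sub>R z) * ?U ((1 / h) *\<^sub>R x - (z + b))))"
    by (simp add: sum_subtractf[symmetric] sum_distrib_left algebra_simps)
  also have "(\<Sum>z\<in>A. f (h *\<^sub>R z) * ?U ((1 / h) *\<^sub>R x - (z + b)))
      = (\<Sum>z\<in>A'. f (h *\<^sub>R (z - b)) * ?U ((1 / h) *\<^sub>R x - z))"
    unfolding A'_def by (subst sum.reindex) (auto simp: inj_on_def)
  also have "\<dots> = (\<Sum>z\<in>A \<union> A'. f (h *\<^sub>R (z - b)) * ?U ((1 / h) *\<^sub>R x - z))"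
    using finA inA f' by (intro sum.mono_neutral_left) (auto simp: A'_def)
  also have "(\<Sum>z\<in>A. f (h *\<^sub>R z) * ?U ((1 / h) *\<^sub>R x - z))
      = (\<Sum>z\<in>A \<union> A'. f (h *\<^sub>R z) * ?U ((1 / h) *\<^sub>R x - z))"
    using finA inA by (intro sum.mono_neutral_left) (auto simp: A_def A'_def)
  also have "(1 / h) * (\<dots> - (\<Sum>z\<in>A \<union> A'. f (h *\<^sub>R (z - b)) * ?U ((1 / h) *\<^sub>R x - z)))
      = (\<Sum>z\<in>A \<union> A'. bdiff h b f (h *\<^sub>R z) * ?U ((1 / h) *\<^sub>R x - z))"
    by (simp add: sum_subtractf[symmetric] sum_distrib_left bdiff_def field_simps)
  also have "\<dots> = quasi (s(b := t)) h (bdiff h b f) x"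
    using finA inA f'
    by (intro quasi_eq[symmetric]) (auto simp: A'_def A_def bdiff_def scaleR_diff_right)
  finally show ?thesis .
qed

lemma partials_quasi:
  assumes h: "h > 0" and f: "bounded {x. f x \<noteq> 0}"
    and "set bs \<subseteq> Basis" "\<And>b. b \<in> Basis \<Longrightarrow> length bs \<le> s b"
  shows "\<exists>s'. (\<forall>b\<in>Basis. s' b \<le> s b \<and> s b \<le> s' b + length bs) \<and>
    partials bs (quasi s h f) = quasi s' h (bdiffs h bs f)"
  using assms(3,4)
proof (induction bs)
  case (Cons b bs)
  have "\<exists>s'. (\<forall>b\<in>Basis. s' b \<le> s b \<and> s b \<le> s' b + length bs) \<and>
    partials bs (quasi s h f) = quasi s' h (bdiffs h bs f)"
    by (rule Cons.IH) (use Cons.prems in force)+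
  then obtain s' where s': "\<And>b. b \<in> Basis \<Longrightarrow> s' b \<le> s b \<and> s b \<le> s' b + length bs"
    "partials bs (quasi s h f) = quasi s' h (bdiffs h bs f)" by blast
  have b: "b \<in> Basis" using Cons.prems by simp
  then have "s' b \<noteq> 0" using s'(1)[OF b] Cons.prems(2)[OF b] by auto
  then obtain t where t: "s' b = Suc t" using not0_implies_Suc by blast
  have "partials (b # bs) (quasi s h f) = quasi (s'(b := t)) h (bdiffs h (b # bs) f)"
    unfolding partials.simps bdiffs.simps s'(2)
    by (intro ext partial_quasi h bounded_support_bdiffs f b t)
  moreover have "\<forall>c\<in>Basis. (s'(b := t)) c \<le> s c \<and> s c \<le> (s'(b := t)) c + length (b # bs)"
    using s'(1) t by fastforce
  ultimately show ?case by blast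
qed (auto intro!: exI[of _ s])

text \<open>The mean value theorem, once for each direction. Every application moves the point by at most
\<open>h\<close>. Difference quotients in different directions commute, so the directions can be processed in
the order in which \<^term>\<open>partials\<close> applies them.\<close>

lemma bdiffs_mean_value:
  assumes "f \<in> C_space m" "bs \<in> directions m" "h > 0"
  shows "\<exists>\<xi>. norm (\<xi> - y) \<le> real (length bs) * h \<and> bdiffs h bs f y = partials bs f \<xi>"
  using assms(1,2)
proof (induction bs arbitrary: f)
  case (Cons b bs)
  then have bs: "bs \<in> directions m" "length bs < m" and b: "b \<in> Basis" by (auto simp: directions_Cons)
  have e: "bdiff h b f = (\<lambda>x. (1 / h) * f x + (- (1 / h)) * f (1 *\<^sub>R x - h *\<^sub>R b))"
    by (auto simp: bdiff_def fun_eq_iff diff_divide_distrib)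
  have C: "(\<lambda>x. f (1 *\<^sub>R x - h *\<^sub>R b)) \<in> C_space m" by (rule C_space_affine[OF Cons.prems(1)])
  have p: "partials bs (bdiff h b f) = (\<lambda>x. (1 / h) * partials bs f x + (- (1 / h)) * partials bs f (x - h *\<^sub>R b))"
    unfolding e partials_lincomb[OF Cons.prems(1) C bs(1)] partials_affine[OF Cons.prems(1) bs(1)] by simp
  have "bdiff h b f \<in> C_space m"
    unfolding e by (rule C_space_lincomb[OF Cons.prems(1) C])
  from Cons.IH[OF this bs(1)] obtain \<xi> where \<xi>: "norm (\<xi> - y) \<le> real (length bs) * h"
    "bdiffs h bs (bdiff h b f) y = partials bs (bdiff h b f) \<xi>" by blast
  let ?p = "\<lambda>t. partials bs f (\<xi> - h *\<^sub>R b + t *\<^sub>R b)"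
  have "(?p has_real_derivative partials (b # bs) f (\<xi> - h *\<^sub>R b + t *\<^sub>R b)) (at t)" for t
  proof -
    have "(?p has_derivative (\<lambda>v. frechet_derivative (partials bs f) (at (\<xi> - h *\<^sub>R b + t *\<^sub>R b)) (v *\<^sub>R b))) (at t)"
      by (rule has_derivative_compose[OF _ has_partial[OF C_spaceD(2)[OF Cons.prems(1) bs]],
            of "\<lambda>t. \<xi> - h *\<^sub>R b + t *\<^sub>R b"]) (auto intro!: derivative_eq_intros)
    then show ?thesis
      using linear_frechet_derivative[OF C_spaceD(2)[OF Cons.prems(1) bs], of "\<xi> - h *\<^sub>R b + t *\<^sub>R b"]
      by (simp add: has_field_derivative_def linear_cmul mult_commute_abs)
  qed
  then obtain t where t: "0 < t" "t < h" "?p h - ?p 0 = (h - 0) * partials (b # bs) f (\<xi> - h *\<^sub>R b + t *\<^sub>R b)"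
    using MVT2[of 0 h ?p "\<lambda>t. partials (b # bs) f (\<xi> - h *\<^sub>R b + t *\<^sub>R b)"] \<open>h > 0\<close> by blast
  have "norm ((\<xi> - h *\<^sub>R b + t *\<^sub>R b) - y) = norm ((\<xi> - y) - (h - t) *\<^sub>R b)"
    by (simp add: algebra_simps)
  also have "\<dots> \<le> norm (\<xi> - y) + norm ((h - t) *\<^sub>R b)" by (rule norm_triangle_ineq4)
  also have "norm ((h - t) *\<^sub>R b) \<le> h" using t b by simp
  finally have "norm ((\<xi> - h *\<^sub>R b + t *\<^sub>R b) - y) \<le> real (length (b # bs)) * h"
    using \<xi>(1) by (simp add: algebra_simps)
  moreover have "bdiffs h (b # bs) f y = partials (b # bs) f (\<xi> - h *\<^sub>R b + t *\<^sub>R b)"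
    using t(3) \<xi>(2) \<open>h > 0\<close> by (simp add: bdiffs_commute[symmetric] p field_simps)
  ultimately show ?case by blast
qed auto

text \<open>The translates of the splines form a partition of unity supported near the nodes, so
\<open>quasi s h f x\<close> is a weighted mean of values of \<open>f\<close> near \<open>x\<close>; it stays as close to \<open>c\<close> as these
values do. For \<open>c = 0\<close> this is also a bound.\<close>

lemma quasi_approx:
  fixes f :: "'a::euclidean_space \<Rightarrow> real"
  assumes h: "h > 0" and f: "bounded {x. f x \<noteq> 0}" and s: "\<And>b. b \<in> Basis \<Longrightarrow> s b \<le> m"
    and c: "\<And>y. norm (y - x) \<le> real DIM('a) * (real m + 2) * h \<Longrightarrow> \<bar>f y - c\<bar> \<le> e"
  shows "\<bar>quasi s h f x - c\<bar> \<le> e"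
proof -
  define X where "X = (1 / h) *\<^sub>R x"
  obtain r where r: "\<And>y. f y \<noteq> 0 \<Longrightarrow> norm y \<le> r" using f by (auto simp: bounded_iff)
  \<comment> \<open>The box must contain the support of the values of \<open>f\<close> and all nodes that contribute to the
    partition of unity at \<open>x\<close>.\<close>
  define N where "N = \<lceil>max (r / h) (norm X + real m + 2)\<rceil>"
  have N: "r / h \<le> of_int N" "norm X + real m + 2 \<le> of_int N"
    using le_of_int_ceiling[of "max (r / h) (norm X + real m + 2)"] unfolding N_def by linarith+
  let ?A = "lattice_box N :: 'a set"
  define w where "w z = tensor (\<lambda>b. spline (s b)) (X - z)" for z
  have nn: "w z \<ge> 0" for z unfolding w_def tensor_def by (intro prod_nonneg) (simp add: spline_nonneg)
  have "sum w ?A = (\<Sum>z\<in>?A. \<Prod>b\<in>Basis. (\<lambda>b t. spline (s b) (X \<bullet> b - t)) b (z \<bullet> b))"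
    by (simp add: w_def tensor_def inner_diff_left)
  also have "\<dots> = (\<Prod>b\<in>Basis. \<Sum>j\<in>{-N..N}. spline (s b) (X \<bullet> b - of_int j))"
    by (subst sum_lattice_box) simp
  also have "\<dots> = 1"
  proof (intro prod.neutral ballI spline_sum)
    fix b :: 'a assume "b \<in> Basis"
    then show "\<bar>X \<bullet> b\<bar> + real (s b) + 2 \<le> of_int N"
      using Basis_le_norm[of b X] s[of b] N(2) by linarith
  qed
  finally have w1: "sum w ?A = 1" .
  have "quasi s h f x = (\<Sum>z\<in>?A. f (h *\<^sub>R z) * w z)"
    unfolding w_def X_def
  proof (rule quasi_eq[OF finite_lattice_box])
    fix z assume z: "z \<in> int_lattice" "f (h *\<^sub>R z) \<noteq> 0"
    have "norm z \<le> r / h" using r[OF z(2)] h by (simp add: field_simps)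
    then show "z \<in> lattice_box N" using N(1) by (intro lattice_boxI[OF z(1)]) linarith
  qed (auto simp: lattice_box_def)
  then have "quasi s h f x - c = (\<Sum>z\<in>?A. f (h *\<^sub>R z) * w z) - c * sum w ?A" using w1 by simp
  also have "\<dots> = (\<Sum>z\<in>?A. w z * (f (h *\<^sub>R z) - c))"
    by (simp add: sum_distrib_left sum_subtractf[symmetric] algebra_simps)
  finally have "\<bar>quasi s h f x - c\<bar> \<le> (\<Sum>z\<in>?A. w z * \<bar>f (h *\<^sub>R z) - c\<bar>)"
    using sum_abs[of "\<lambda>z. w z * (f (h *\<^sub>R z) - c)" ?A] nn by (simp add: abs_mult)
  also have "\<dots> \<le> (\<Sum>z\<in>?A. w z * e)"
  proof (rule sum_mono)
    fix z :: 'a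
    show "w z * \<bar>f (h *\<^sub>R z) - c\<bar> \<le> w z * e"
    proof (cases "w z = 0")
      case False
      have "norm (h *\<^sub>R z - x) \<le> (\<Sum>b\<in>Basis. \<bar>(h *\<^sub>R z - x) \<bullet> b\<bar>)" by (rule norm_le_l1)
      also have "\<dots> \<le> (\<Sum>b\<in>(Basis::'a set). (real m + 2) * h)"
      proof (rule sum_mono)
        fix b :: 'a assume b: "b \<in> Basis"
        then have "spline (s b) ((X - z) \<bullet> b) \<noteq> 0"
          using False by (auto simp: w_def tensor_def)
        then have "0 < (X - z) \<bullet> b" "(X - z) \<bullet> b < real (s b) + 2"
          using spline_eq_0 by (meson not_le)+
        moreover have "(h *\<^sub>R z - x) \<bullet> b = - h * ((X - z) \<bullet> b)"
          using h by (simp add: X_def inner_diff_left field_simps)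
        ultimately show "\<bar>(h *\<^sub>R z - x) \<bullet> b\<bar> \<le> (real m + 2) * h"
          using h s[OF b] by (auto simp: abs_mult mult.commute intro!: mult_right_mono)
      qed
      also have "\<dots> = real DIM('a) * (real m + 2) * h" by simp
      finally show ?thesis using c nn by (intro mult_left_mono) auto
    qed simp
  qed
  also have "\<dots> = e" using w1 by (simp add: sum_distrib_right[symmetric])
  finally show ?thesis .
qed

text \<open>The reach of the operator in units of the mesh: the support of a tensor product of splines (in the
Euclidean norm) plus the displacement in \<open>bdiffs_mean_value\<close>.\<close>

definition spread :: "'a::euclidean_space itself \<Rightarrow> nat \<Rightarrow> real" where
  "spread _ m = real DIM('a) * (real m + 2) + real m"

text \<open>The properties above combined: a partial derivative of the quasi-interpolant is a weighted mean of
the same partial derivative of \<open>f\<close> near \<open>x\<close>. Both convergence and boundedness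
follow from this.\<close>

lemma partials_quasi_approx:
  fixes f :: "'a::euclidean_space \<Rightarrow> real"
  assumes h: "h > 0" and f: "bounded {x. f x \<noteq> 0}" "f \<in> C_space l" "l \<le> m" and bs: "bs \<in> directions l"
    and c: "\<And>y. norm (y - x) \<le> spread TYPE('a) m * h \<Longrightarrow> \<bar>partials bs f y - c\<bar> \<le> e"
  shows "\<bar>partials bs (quasi (\<lambda>_. m) h f) x - c\<bar> \<le> e"
proof -
  obtain s' where s': "\<And>b. b \<in> Basis \<Longrightarrow> s' b \<le> m"
    "partials bs (quasi (\<lambda>_. m) h f) = quasi s' h (bdiffs h bs f)"
    using partials_quasi[OF h f(1), of bs "\<lambda>_. m"] bs f(3) by (auto simp: directions_def)
  show ?thesis
    unfolding s'(2)
  proof (rule quasi_approx[OF h bounded_support_bdiffs[OF f(1)] s'(1)])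
    fix y assume y: "norm (y - x) \<le> real DIM('a) * (real m + 2) * h"
    obtain \<xi> where \<xi>: "norm (\<xi> - y) \<le> real (length bs) * h" "bdiffs h bs f y = partials bs f \<xi>"
      using bdiffs_mean_value[OF f(2) bs h] by blast
    have "real (length bs) * h \<le> real m * h" using bs f(3) h by (auto simp: directions_def)
    then have "norm (\<xi> - x) \<le> spread TYPE('a) m * h"
      using \<xi>(1) y norm_triangle_ineq[of "\<xi> - y" "y - x"] by (simp add: spread_def algebra_simps)
    then show "\<bar>bdiffs h bs f y - c\<bar> \<le> e" using c \<xi>(2) by simp
  qed
qed

section \<open>Discretization with a cutoff\<close>

text \<open>The cutoff lives on the scale \<open>1 / h\<close>, so it disappears locally as the mesh tends to zero, while
its derivatives remain bounded.\<close>

definition discretize :: "nat \<Rightarrow> real \<Rightarrow> ('a::euclidean_space \<Rightarrow> real) \<Rightarrow> 'a \<Rightarrow> real" where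
  "discretize m h g = quasi (\<lambda>_. m) h (\<lambda>x. cutoff (h *\<^sub>R x) * g x)"

definition nodes :: "real \<Rightarrow> 'a::euclidean_space set" where
  "nodes h = {z \<in> int_lattice. cutoff (h *\<^sub>R h *\<^sub>R z) \<noteq> 0}"

definition weight :: "nat \<Rightarrow> real \<Rightarrow> 'a::euclidean_space \<Rightarrow> 'a \<Rightarrow> real" where
  "weight m h z x = cutoff (h *\<^sub>R h *\<^sub>R z) * tensor (\<lambda>_. spline m) ((1 / h) *\<^sub>R x - z)"

lemma bounded_support_cutoff_mult:
  assumes "h > 0"
  shows "bounded {x. cutoff (h *\<^sub>R x) * g x \<noteq> 0}"
proof -
  have "{x. cutoff (h *\<^sub>R x) * g x \<noteq> 0} \<subseteq> (\<lambda>x. (1 / h) *\<^sub>R x) ` {x. cutoff x \<noteq> 0}"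
    using assms by (auto intro!: image_eqI[of x _ "h *\<^sub>R x" for x])
  then show ?thesis using bounded_scaling[OF bounded_support_cutoff] bounded_subset by blast
qed

lemma finite_nodes:
  assumes "h > 0"
  shows "finite (nodes h)"
  using finite_lattice_if_bounded[OF bounded_support_cutoff_mult[OF assms, of "\<lambda>_. 1"] assms]
  by (simp add: nodes_def)

lemma discretize_eq_sum:
  assumes "h > 0"
  shows "discretize m h g x = (\<Sum>z\<in>nodes h. weight m h z x * g (h *\<^sub>R z))"
  unfolding discretize_def
  by (subst quasi_eq[OF finite_nodes[OF assms]]) (auto simp: nodes_def weight_def mult_ac intro!: sum.cong)

text \<open>Cutoff, splines and integer points are all compatible with products; hence discretization on
\<open>\<real>\<^sup>2\<^sup>d\<close> is discretization in each of the two variables.\<close>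

lemma nodes_pair: "nodes h = nodes h \<times> nodes h"
  by (auto simp: nodes_def lattice_pair cutoff_def tensor_pair)

lemma weight_pair: "weight m h (w, z) (x, y) = weight m h w x * weight m h z y"
  by (simp add: weight_def cutoff_def tensor_pair)

lemma weight_nonneg: "0 \<le> weight m h z x"
  unfolding weight_def tensor_def by (intro mult_nonneg_nonneg prod_nonneg) (auto simp: cutoff_range spline_nonneg)

lemma smooth_weight:
  fixes z :: "'a::euclidean_space"
  shows "smooth (weight m h z)"
proof -
  have "weight m h z \<in> C_space l" for l
    using smooth_tensor_spline[of "\<lambda>_::'a. m"] unfolding weight_def[abs_def]
    by (intro C_space_mult[OF C_space_const C_space_affine]) (simp add: smooth_def)
  then show ?thesis by (simp add: smooth_def)
qed

lemma bounded_support_weight: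
  fixes z :: "'a::euclidean_space"
  assumes "h > 0"
  shows "bounded {x. weight m h z x \<noteq> 0}"
proof -
  have "\<bar>((1 / h) *\<^sub>R x - z) \<bullet> b\<bar> \<le> real m + 2" if "weight m h z x \<noteq> 0" "b \<in> Basis" for x b
  proof -
    have "spline m (((1 / h) *\<^sub>R x - z) \<bullet> b) \<noteq> 0"
      using that by (force simp: weight_def tensor_def)
    then show ?thesis using spline_eq_0[of "((1 / h) *\<^sub>R x - z) \<bullet> b" m] by force
  qed
  then have "norm ((1 / h) *\<^sub>R x - z) \<le> (\<Sum>b\<in>(Basis::'a set). real m + 2)" if "weight m h z x \<noteq> 0" for x
    using that norm_le_l1[of "(1 / h) *\<^sub>R x - z"] sum_mono by (smt (verit, best))
  then have "bounded {y. \<exists>x. weight m h z x \<noteq> 0 \<and> y = (1 / h) *\<^sub>R x - z}"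
    by (force simp: bounded_iff)
  from bounded_scaling[OF bounded_translation[OF this, of z], of h]
  show ?thesis by (rule bounded_subset) (use assms in \<open>force simp: image_iff\<close>)
qed

lemma C_space_cutoff_mult:
  assumes "g \<in> C_space l"
  shows "(\<lambda>x. cutoff (h *\<^sub>R x) * g x) \<in> C_space l"
  using C_space_affine[of cutoff l h 0] smooth_cutoff assms
  by (intro C_space_mult) (auto simp: smooth_def)

lemma smooth_discretize: "smooth (discretize m h g)"
  by (simp add: discretize_def smooth_quasi)

text \<open>Continuous convergence: \<open>f\<^sub>n(y) \<rightarrow> l(x)\<close> as \<open>n \<rightarrow> \<infinity>\<close> and \<open>y \<rightarrow> x\<close>. It is local, it is what joint
continuity in measure and point gives directly, and it implies uniform convergence on compact
sets.\<close>

definition converges_continuously :: "(nat \<Rightarrow> 'a::metric_space \<Rightarrow> real) \<Rightarrow> ('a \<Rightarrow> real) \<Rightarrow> bool" where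
  "converges_continuously f l \<longleftrightarrow>
     (\<forall>x. \<forall>e>0. \<exists>d>0. \<exists>N. \<forall>n\<ge>N. \<forall>y. dist y x < d \<longrightarrow> \<bar>f n y - l x\<bar> < e)"

text \<open>Each point has a neighbourhood on which finally all functions are close to the value of the limit
at that point, and finitely many such neighbourhoods cover \<open>K\<close>.\<close>

lemma converges_continuously_imp_uniform_limit:
  assumes f: "converges_continuously f l" and K: "compact K"
  shows "uniform_limit K f l sequentially"
proof (rule uniform_limitI)
  fix e :: real assume e: "e > 0"
  have "\<forall>x. \<exists>d>0. \<exists>N. \<forall>n\<ge>N. \<forall>y. dist y x < d \<longrightarrow> \<bar>f n y - l x\<bar> < e / 2"
    using f e unfolding converges_continuously_def by (meson half_gt_zero)
  then obtain d N where dN: "\<And>x. d x > 0" "\<And>x n y. n \<ge> N x \<Longrightarrow> dist y x < d x \<Longrightarrow> \<bar>f n y - l x\<bar> < e / 2"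
    by metis
  obtain X where X: "X \<subseteq> K" "finite X" "K \<subseteq> (\<Union>x\<in>X. ball x (d x))"
    using compactE_image[OF K, of K "\<lambda>x. ball x (d x)"] dN(1) by force
  have l: "\<bar>l y - l x\<bar> \<le> e / 2" if "dist y x < d x" for x y
  proof (rule field_le_epsilon)
    fix \<delta> :: real assume "\<delta> > 0"
    then obtain r M where "r > 0" and M: "\<And>n z. n \<ge> M \<Longrightarrow> dist z y < r \<Longrightarrow> \<bar>f n z - l y\<bar> < \<delta>"
      using f unfolding converges_continuously_def by meson
    have "\<bar>f (max M (N x)) y - l y\<bar> < \<delta>" using \<open>r > 0\<close> by (intro M) auto
    moreover have "\<bar>f (max M (N x)) y - l x\<bar> < e / 2" using that by (intro dN(2)) auto
    ultimately show "\<bar>l y - l x\<bar> \<le> e / 2 + \<delta>" by linarith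
  qed
  have "dist (f n y) (l y) < e" if n: "n \<ge> Max (insert 0 (N ` X))" and y: "y \<in> K" for n y
  proof -
    obtain x where x: "x \<in> X" "dist y x < d x" using X y by (auto simp: dist_commute)
    then have "N x \<le> n" using n X(2) by (meson Max_ge finite_imageI finite_insert image_eqI insertI2 le_trans)
    then show ?thesis using dN(2)[OF _ x(2)] l[OF x(2)] by (auto simp: dist_real_def) (smt (verit) field_sum_of_halves)
  qed
  then show "\<forall>\<^sub>F n in sequentially. \<forall>y\<in>K. dist (f n y) (l y) < e"
    by (auto simp: eventually_sequentially)
qed

abbreviation mesh :: "nat \<Rightarrow> real" where
  "mesh n \<equiv> 1 / (real n + 1)"

text \<open>For large \<open>n\<close> the cutoff is one near \<open>x\<close>, and the points whose values enter the weighted mean are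
within the neighbourhood that the continuous convergence of the arguments provides.\<close>

lemma partials_discretize_converge:
  fixes g :: "nat \<Rightarrow> 'a::euclidean_space \<Rightarrow> real"
  assumes g: "\<And>n. g n \<in> C_space l" and "l \<le> m" and bs: "bs \<in> directions l"
    and conv: "converges_continuously (\<lambda>n. partials bs (g n)) G"
  shows "converges_continuously (\<lambda>n. partials bs (discretize m (mesh n) (g n))) G"
  unfolding converges_continuously_def
proof (intro allI impI)
  fix x :: 'a and e :: real assume e: "e > 0"
  obtain d N where d: "d > 0" and N: "\<And>n y. n \<ge> N \<Longrightarrow> dist y x < d \<Longrightarrow> \<bar>partials bs (g n) y - G x\<bar> < e / 2"
    using conv e unfolding converges_continuously_def by (meson half_gt_zero)
  let ?K = "spread TYPE('a) m"
  have K: "?K \<ge> 0" by (simp add: spread_def)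
  obtain N' where N': "real N' \<ge> max (2 * ?K / d) (norm x + d + 1)" using real_arch_simple by blast
  have "\<bar>partials bs (discretize m (mesh n) (g n)) y - G x\<bar> < e"
    if n: "n \<ge> max N N'" and y: "dist y x < d / 2" for n y
  proof -
    have h: "mesh n > 0" by simp
    have nr: "real n \<ge> real N'" using n by simp
    have "?K * 2 \<le> d * (real n + 1)"
    proof -
      have "2 * ?K / d \<le> real n + 1" using N' nr by linarith
      then show ?thesis using d by (simp add: field_simps)
    qed
    then have Kh: "?K * mesh n \<le> d / 2" by (simp add: field_simps)
    let ?c = "\<lambda>x. cutoff (mesh n *\<^sub>R x) * g n x"
    have "\<bar>partials bs (quasi (\<lambda>_. m) (mesh n) ?c) y - G x\<bar> \<le> e / 2"
    proof (rule partials_quasi_approx[OF h bounded_support_cutoff_mult[OF h]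
          C_space_cutoff_mult[OF g] \<open>l \<le> m\<close> bs])
      fix z assume z: "norm (z - y) \<le> ?K * mesh n"
      have zx: "dist z x < d"
        using z Kh y dist_triangle[of z x y] unfolding dist_norm by linarith
      have "partials bs ?c z = partials bs (g n) z"
      proof (rule partials_cong_open[of "ball x d"])
        fix w assume "w \<in> ball x d"
        then have "norm w \<le> norm x + d"
          using norm_triangle_ineq[of x "w - x"] by (auto simp: dist_norm norm_minus_commute)
        then have "norm w \<le> real n + 1" using N' nr by linarith
        then have "norm (mesh n *\<^sub>R w) \<le> 1" by (simp add: field_simps)
        then have "cutoff (mesh n *\<^sub>R w) = 1" by (rule cutoff_eq_1)
        then show "?c w = g n w" by simp
      qed (use zx in \<open>auto simp: dist_commute\<close>)
      then show "\<bar>partials bs ?c z - G x\<bar> \<le> e / 2"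
        using N[OF _ zx, of n] n by auto
    qed
    then show ?thesis using e by (simp add: discretize_def)
  qed
  then show "\<exists>d>0. \<exists>N. \<forall>n\<ge>N. \<forall>y. dist y x < d \<longrightarrow> \<bar>partials bs (discretize m (mesh n) (g n)) y - G x\<bar> < e"
    using d by (intro exI[of _ "d / 2"] conjI exI[of _ "max N N'"]) auto
qed

text \<open>The constant comes from the Leibniz rule applied to the cutoff, whose dilation by \<open>h \<le> 1\<close>
only decreases derivatives; hence it is independent of the mesh.\<close>

lemma partials_discretize_bound:
  obtains B where "B \<ge> 0"
    "\<And>h M bs x g. 0 < h \<Longrightarrow> h \<le> 1 \<Longrightarrow> g \<in> C_space m \<Longrightarrow> bs \<in> directions m \<Longrightarrow>
       (\<And>cs y. cs \<in> directions m \<Longrightarrow> \<bar>partials cs g y\<bar> \<le> M) \<Longrightarrow>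
       \<bar>partials bs (discretize m h g) (x::'a::euclidean_space)\<bar> \<le> B * M"
proof -
  obtain C where C: "C \<ge> 0" "\<And>bs x. bs \<in> directions m \<Longrightarrow> \<bar>partials bs cutoff (x::'a)\<bar> \<le> C"
    using partials_bounded_if_bounded_support[OF smooth_cutoff bounded_support_cutoff] by metis
  have "\<bar>partials bs (discretize m h g) x\<bar> \<le> (2 ^ m * C) * M"
    if h: "0 < h" "h \<le> 1" and g: "g \<in> C_space m" and bs: "bs \<in> directions m"
      and M: "\<And>cs y. cs \<in> directions m \<Longrightarrow> \<bar>partials cs g y\<bar> \<le> M" for h M bs g and x :: 'a
  proof -
    have M0: "M \<ge> 0" using M[OF Nil_in_directions] abs_ge_zero order_trans by blast
    have c: "\<bar>partials cs (\<lambda>x. cutoff (h *\<^sub>R x)) y\<bar> \<le> C" if cs: "cs \<in> directions m" for cs and y :: 'a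
    proof -
      have "(cutoff :: 'a \<Rightarrow> real) \<in> C_space m" using smooth_cutoff[where 'a = 'a] by (simp add: smooth_def)
      from partials_affine[OF this cs, of h 0]
      have "\<bar>partials cs (\<lambda>x. cutoff (h *\<^sub>R x)) y\<bar> = h ^ length cs * \<bar>partials cs cutoff (h *\<^sub>R y)\<bar>"
        using h by (simp add: abs_mult)
      also have "\<dots> \<le> 1 * C" using h C cs by (intro mult_mono) (auto intro: power_le_one)
      finally show ?thesis by simp
    qed
    have cC: "(\<lambda>x::'a. cutoff (h *\<^sub>R x)) \<in> C_space m"
      using C_space_cutoff_mult[OF C_space_const[of 1], of h] by simp
    have "\<bar>partials bs (quasi (\<lambda>_. m) h (\<lambda>x. cutoff (h *\<^sub>R x) * g x)) x - 0\<bar> \<le> (2 ^ m * C) * M"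
    proof (rule partials_quasi_approx[OF h(1) bounded_support_cutoff_mult[OF h(1)]
          C_space_cutoff_mult[OF g] order_refl bs])
      fix y
      have "\<bar>partials bs (\<lambda>x. cutoff (h *\<^sub>R x) * g x) y\<bar> \<le> 2 ^ length bs * (C * M)"
        by (rule partials_mult_le[OF cC g bs c M])
      also have "\<dots> \<le> 2 ^ m * (C * M)"
        using bs C M0 by (intro mult_right_mono power_increasing) (auto simp: directions_def)
      finally show "\<bar>partials bs (\<lambda>x. cutoff (h *\<^sub>R x) * g x) y - 0\<bar> \<le> (2 ^ m * C) * M" by (simp add: mult.assoc)
    qed
    then show ?thesis by (simp add: discretize_def)
  qed
  then show thesis using that[of "2 ^ m * C"] C by auto
qed

text \<open>The cutoff takes values within \<open>1/2\<close> of \<open>1/2\<close>, so its quasi-interpolant, the sum of the weights,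
does too.\<close>

lemma sum_weight_le_1:
  fixes x :: "'a::euclidean_space"
  assumes "h > 0"
  shows "(\<Sum>z\<in>nodes h. weight m h z x) \<le> 1"
proof -
  have "\<bar>quasi (\<lambda>_. m) h (\<lambda>x. cutoff (h *\<^sub>R x) * 1) x - 1 / 2\<bar> \<le> 1 / 2"
  proof (rule quasi_approx[OF assms bounded_support_cutoff_mult[OF assms] order_refl])
    fix y :: 'a
    show "\<bar>cutoff (h *\<^sub>R y) * 1 - 1 / 2\<bar> \<le> 1 / (2::real)"
      using cutoff_range[of "h *\<^sub>R y"] by linarith
  qed
  moreover have "quasi (\<lambda>_. m) h (\<lambda>x. cutoff (h *\<^sub>R x) * 1) x = (\<Sum>z\<in>nodes h. weight m h z x)"
    using discretize_eq_sum[OF assms, of m "\<lambda>_. 1" x] by (simp add: discretize_def)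
  ultimately show "(\<Sum>z\<in>nodes h. weight m h z x) \<le> 1" by linarith
qed

section \<open>Finite measures and atoms\<close>

lemma finite_measuresD:
  assumes "\<mu> \<in> finite_measures"
  shows "sets \<mu> = sets borel" "space \<mu> = UNIV" "finite_measure \<mu>"
  using assms sets_eq_imp_space_eq[of \<mu> borel] by (auto simp: finite_measures_def)

definition bounded_continuous :: "('a::euclidean_space \<Rightarrow> real) \<Rightarrow> bool" where
  "bounded_continuous \<phi> \<longleftrightarrow> continuous_on UNIV \<phi> \<and> bounded (range \<phi>)"

lemma bounded_continuous_integrable:
  assumes "\<mu> \<in> finite_measures" "bounded_continuous \<phi>"
  shows "integrable \<mu> \<phi>"
proof -
  interpret finite_measure \<mu> using finite_measuresD(3)[OF assms(1)] .
  have "\<phi> \<in> borel_measurable \<mu>"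
    using assms borel_measurable_continuous_onI[of \<phi>] finite_measuresD(1)[OF assms(1)]
    by (simp add: bounded_continuous_def cong: measurable_cong_sets)
  moreover obtain B where "\<And>x. norm (\<phi> x) \<le> B"
    using assms(2) by (auto simp: bounded_continuous_def bounded_iff)
  ultimately show ?thesis by (intro integrable_const_bound[of _ B]) auto
qed

lemma nn_integral_add_dirac:
  assumes \<mu>: "\<mu> \<in> finite_measures" and f: "f \<in> borel_measurable borel"
  shows "(\<integral>\<^sup>+ y. f y \<partial>add_dirac \<mu> \<epsilon> x) = (\<integral>\<^sup>+ y. f y \<partial>\<mu>) + ennreal \<epsilon> * f x"
  using f
proof (induction rule: borel_measurable_induct)
  case (cong f g)
  then have "f = g" by (auto simp: fun_eq_iff)
  then show ?case using cong by simp
next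
  case (set A)
  then show ?case
    using finite_measuresD(1)[OF \<mu>] by (simp add: emeasure_add_dirac[OF \<mu>])
next
  case (mult u c)
  then have "u \<in> borel_measurable \<mu>" "u \<in> borel_measurable (add_dirac \<mu> \<epsilon> x)"
    using finite_measuresD(1)[OF \<mu>] by (simp_all cong: measurable_cong_sets)
  then show ?case using mult by (simp add: nn_integral_cmult distrib_left mult_ac)
next
  case (add u v)
  then have "u \<in> borel_measurable \<mu>" "u \<in> borel_measurable (add_dirac \<mu> \<epsilon> x)"
    "v \<in> borel_measurable \<mu>" "v \<in> borel_measurable (add_dirac \<mu> \<epsilon> x)"
    using finite_measuresD(1)[OF \<mu>] by (simp_all cong: measurable_cong_sets)
  then show ?case using add by (simp add: nn_integral_add distrib_left add_ac)
next
  case (seq U)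
  then have m: "U i \<in> borel_measurable \<mu>" "U i \<in> borel_measurable (add_dirac \<mu> \<epsilon> x)" for i
    using finite_measuresD(1)[OF \<mu>] by (simp_all cong: measurable_cong_sets)
  have inc: "incseq (\<lambda>i. U i x)" using seq by (auto simp: incseq_def le_fun_def)
  have "(\<integral>\<^sup>+ y. (SUP i. U i) y \<partial>add_dirac \<mu> \<epsilon> x) = (SUP i. \<integral>\<^sup>+ y. U i y \<partial>add_dirac \<mu> \<epsilon> x)"
    using nn_integral_monotone_convergence_SUP[OF seq(3) m(2)] by (simp add: image_comp)
  also have "\<dots> = (SUP i. (\<integral>\<^sup>+ y. U i y \<partial>\<mu>) + ennreal \<epsilon> * U i x)"
    using seq by simp
  also have "\<dots> = (SUP i. \<integral>\<^sup>+ y. U i y \<partial>\<mu>) + (SUP i. ennreal \<epsilon> * U i x)"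
    using seq(3) inc
    by (intro ennreal_SUP_add)
       (auto simp: incseq_def le_fun_def intro!: nn_integral_mono mult_left_mono)
  also have "(SUP i. \<integral>\<^sup>+ y. U i y \<partial>\<mu>) = (\<integral>\<^sup>+ y. (SUP i. U i) y \<partial>\<mu>)"
    using nn_integral_monotone_convergence_SUP[OF seq(3) m(1)] by (simp add: image_comp)
  also have "(SUP i. ennreal \<epsilon> * U i x) = ennreal \<epsilon> * (SUP i. U i) x"
    by (simp add: SUP_mult_left_ennreal image_comp)
  finally show ?case .
qed

lemma integral_add_dirac:
  assumes \<mu>: "\<mu> \<in> finite_measures" and \<phi>: "bounded_continuous \<phi>" and \<epsilon>: "\<epsilon> \<ge> 0"
  shows "(\<integral>y. \<phi> y \<partial>add_dirac \<mu> \<epsilon> x) = (\<integral>y. \<phi> y \<partial>\<mu>) + \<epsilon> * \<phi> x"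
proof -
  have nonneg: "(\<integral>y. \<psi> y \<partial>add_dirac \<mu> \<epsilon> x) = (\<integral>y. \<psi> y \<partial>\<mu>) + \<epsilon> * \<psi> x"
    if \<psi>: "bounded_continuous \<psi>" "\<And>y. \<psi> y \<ge> 0" for \<psi>
  proof -
    have m: "\<psi> \<in> borel_measurable borel"
      using \<psi>(1) by (simp add: bounded_continuous_def borel_measurable_continuous_onI)
    have "ennreal (\<integral>y. \<psi> y \<partial>add_dirac \<mu> \<epsilon> x) = (\<integral>\<^sup>+ y. ennreal (\<psi> y) \<partial>add_dirac \<mu> \<epsilon> x)"
      by (rule nn_integral_eq_integral[symmetric])
         (simp_all add: bounded_continuous_integrable[OF add_dirac_in_finite_measures[OF \<mu>] \<psi>(1)] \<psi>(2))
    also have "\<dots> = (\<integral>\<^sup>+ y. ennreal (\<psi> y) \<partial>\<mu>) + ennreal \<epsilon> * ennreal (\<psi> x)"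
      using m by (intro nn_integral_add_dirac[OF \<mu>]) simp
    also have "(\<integral>\<^sup>+ y. ennreal (\<psi> y) \<partial>\<mu>) = ennreal (\<integral>y. \<psi> y \<partial>\<mu>)"
      by (rule nn_integral_eq_integral) (simp_all add: bounded_continuous_integrable[OF \<mu> \<psi>(1)] \<psi>(2))
    also have "ennreal (\<integral>y. \<psi> y \<partial>\<mu>) + ennreal \<epsilon> * ennreal (\<psi> x) = ennreal ((\<integral>y. \<psi> y \<partial>\<mu>) + \<epsilon> * \<psi> x)"
      using \<epsilon> \<psi>(2) by (simp add: ennreal_plus ennreal_mult integral_nonneg_AE)
    finally show ?thesis
      using \<epsilon> \<psi>(2) by (subst (asm) ennreal_inj) (auto simp: integral_nonneg_AE)
  qed
  obtain B where B: "\<And>y. \<bar>\<phi> y\<bar> \<le> B"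
    using \<phi> by (auto simp: bounded_continuous_def bounded_iff)
  have c: "bounded_continuous (\<lambda>_. B)" by (auto simp: bounded_continuous_def)
  have "bounded_continuous (\<lambda>y. \<phi> y + B)"
    using \<phi> by (auto simp: bounded_continuous_def intro!: continuous_intros bounded_plus_comp)
  moreover have pos: "0 \<le> \<phi> y + B" "0 \<le> B" for y using B[of y] by linarith+
  ultimately have "(\<integral>y. \<phi> y + B \<partial>add_dirac \<mu> \<epsilon> x) = (\<integral>y. \<phi> y + B \<partial>\<mu>) + \<epsilon> * (\<phi> x + B)"
    by (intro nonneg)
  moreover have "(\<integral>y. B \<partial>add_dirac \<mu> \<epsilon> x) = (\<integral>y. B \<partial>\<mu>) + \<epsilon> * B"
    by (rule nonneg[OF c pos(2)])
  moreover have "(\<integral>y. \<phi> y + B \<partial>\<nu>) = (\<integral>y. \<phi> y \<partial>\<nu>) + (\<integral>y. B \<partial>\<nu>)" if "\<nu> \<in> finite_measures" for \<nu>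
    by (intro Bochner_Integration.integral_add bounded_continuous_integrable that \<phi> c)
  ultimately show ?thesis
    using \<mu> add_dirac_in_finite_measures[OF \<mu>] by (simp add: algebra_simps)
qed

lemma finite_measures_eqI:
  assumes "\<mu> \<in> finite_measures" "\<nu> \<in> finite_measures"
    and "\<And>A. A \<in> sets borel \<Longrightarrow> emeasure \<mu> A = emeasure \<nu> A"
  shows "\<mu> = \<nu>"
  using assms by (intro measure_eqI) (auto simp: finite_measuresD)

lemma add_dirac_0: "\<mu> \<in> finite_measures \<Longrightarrow> add_dirac \<mu> 0 x = \<mu>"
  by (rule finite_measures_eqI) (auto simp: add_dirac_in_finite_measures emeasure_add_dirac)

lemma add_dirac_add_dirac:
  assumes "\<mu> \<in> finite_measures" "s \<ge> 0" "t \<ge> 0"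
  shows "add_dirac (add_dirac \<mu> s x) t x = add_dirac \<mu> (s + t) x"
  using assms
  by (intro finite_measures_eqI)
     (auto simp: add_dirac_in_finite_measures emeasure_add_dirac ennreal_plus distrib_right add_ac)

primrec add_atoms :: "'a::euclidean_space measure \<Rightarrow> (nat \<Rightarrow> real) \<Rightarrow> (nat \<Rightarrow> 'a) \<Rightarrow> nat \<Rightarrow> 'a measure" where
  "add_atoms \<nu> c \<xi> 0 = \<nu>"
| "add_atoms \<nu> c \<xi> (Suc p) = add_dirac (add_atoms \<nu> c \<xi> p) (c p) (\<xi> p)"

lemma add_atoms_in_finite_measures: "\<nu> \<in> finite_measures \<Longrightarrow> add_atoms \<nu> c \<xi> p \<in> finite_measures"
  by (induction p) (auto intro: add_dirac_in_finite_measures)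

lemma add_atoms_cong: "(\<And>i. i < p \<Longrightarrow> c i = c' i) \<Longrightarrow> add_atoms \<nu> c \<xi> p = add_atoms \<nu> c' \<xi> p"
  by (induction p) auto

lemma emeasure_add_atoms:
  assumes "\<nu> \<in> finite_measures" "A \<in> sets borel"
  shows "emeasure (add_atoms \<nu> c \<xi> p) A = emeasure \<nu> A + (\<Sum>i<p. ennreal (c i) * indicator A (\<xi> i))"
  by (induction p) (simp_all add: emeasure_add_dirac add_atoms_in_finite_measures assms add.assoc)

lemma integral_add_atoms:
  assumes "\<nu> \<in> finite_measures" "bounded_continuous \<phi>" "\<And>i. i < p \<Longrightarrow> c i \<ge> 0"
  shows "(\<integral>y. \<phi> y \<partial>add_atoms \<nu> c \<xi> p) = (\<integral>y. \<phi> y \<partial>\<nu>) + (\<Sum>i<p. c i * \<phi> (\<xi> i))"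
  using assms(3)
  by (induction p) (simp_all add: integral_add_dirac add_atoms_in_finite_measures assms(1,2))

lemma continuous_map_into_weak_topology:
  assumes "\<And>x. x \<in> topspace X \<Longrightarrow> f x \<in> finite_measures"
    and "\<And>\<phi>. bounded_continuous \<phi> \<Longrightarrow> continuous_map X euclideanreal (\<lambda>x. \<integral>y. \<phi> y \<partial>f x)"
  shows "continuous_map X weak_topology f"
  unfolding weak_topology_def
proof (rule continuous_on_generated_topo)
  fix U assume "U \<in> {{\<mu> \<in> finite_measures. (\<integral>x. \<phi> x \<partial>\<mu>) \<in> U} | (\<phi> :: 'b \<Rightarrow> real) U.
        continuous_on UNIV \<phi> \<and> bounded (range \<phi>) \<and> open U}"
  then obtain \<phi> :: "'b \<Rightarrow> real" and V where U: "U = {\<mu> \<in> finite_measures. (\<integral>x. \<phi> x \<partial>\<mu>) \<in> V}"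
    "bounded_continuous \<phi>" "open V" by (auto simp: bounded_continuous_def)
  have "f -` U \<inter> topspace X = {x \<in> topspace X. (\<integral>y. \<phi> y \<partial>f x) \<in> V}"
    using assms(1) U(1) by auto
  then show "openin X (f -` U \<inter> topspace X)"
    using openin_continuous_map_preimage[OF assms(2)[OF U(2)]] U(3) by simp
next
  have "f ` topspace X \<subseteq> topspace weak_topology"
    using assms(1) by (auto simp: topspace_weak_topology)
  then show "f ` topspace X \<subseteq> \<Union> {{\<mu> \<in> finite_measures. (\<integral>x. \<phi> x \<partial>\<mu>) \<in> U} | (\<phi> :: 'b \<Rightarrow> real) U.
        continuous_on UNIV \<phi> \<and> bounded (range \<phi>) \<and> open U}"
    by (simp add: weak_topology_def)
qed

text \<open>Weak convergence can be tested on the subbasis, that is, on integrals of bounded continuous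
functions.\<close>

lemma limitin_weak_topology:
  assumes l: "l \<in> finite_measures" and f: "\<forall>\<^sub>F t in T. f t \<in> finite_measures"
    and \<phi>: "\<And>\<phi>. bounded_continuous \<phi> \<Longrightarrow> ((\<lambda>t. \<integral>y. \<phi> y \<partial>f t) \<longlongrightarrow> (\<integral>y. \<phi> y \<partial>l)) T"
  shows "limitin weak_topology f l T"
  unfolding limitin_def
proof (intro conjI allI impI)
  show "l \<in> topspace weak_topology" using l by (simp add: topspace_weak_topology)
  fix U assume U: "openin weak_topology U \<and> l \<in> U"
  then have "generate_topology_on {{\<mu> \<in> finite_measures. (\<integral>x. \<phi> x \<partial>\<mu>) \<in> U} | (\<phi> :: 'a \<Rightarrow> real) U.
        continuous_on UNIV \<phi> \<and> bounded (range \<phi>) \<and> open U} U"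
    by (simp add: weak_topology_def openin_topology_generated_by_iff)
  moreover have "l \<in> U" using U by simp
  ultimately show "\<forall>\<^sub>F t in T. f t \<in> U"
  proof (induction rule: generate_topology_on.induct)
    case (Int a b)
    then show ?case by (auto intro: eventually_conj)
  next
    case (UN K)
    then obtain k where k: "k \<in> K" "l \<in> k" by auto
    then have "\<forall>\<^sub>F t in T. f t \<in> k" using UN by blast
    then show ?case by (rule eventually_mono) (use k in auto)
  next
    case (Basis s)
    then obtain \<phi> :: "'a \<Rightarrow> real" and V where s: "s = {\<mu> \<in> finite_measures. (\<integral>x. \<phi> x \<partial>\<mu>) \<in> V}"
      "bounded_continuous \<phi>" "open V" by (auto simp: bounded_continuous_def)
    then have "\<forall>\<^sub>F t in T. (\<integral>x. \<phi> x \<partial>f t) \<in> V"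
      using \<phi> Basis(2) by (intro topological_tendstoD) auto
    with f show ?case by eventually_elim (simp add: s(1))
  qed simp
qed

lemma tendsto_continuous_map_weak:
  assumes "continuous_map weak_topology euclideanreal G" "limitin weak_topology f l T"
  shows "((\<lambda>t. G (f t)) \<longlongrightarrow> G l) T"
  using continuous_map_limit[OF assms] by (simp add: limitin_canonical_iff o_def)

section \<open>Derivatives along half-lines of measures\<close>

text \<open>After the last point where \<open>w \<le> 0\<close> the function would be positive, so its right derivative there
could not be negative.\<close>

lemma nonpos_if_right_derivative_neg:
  fixes w :: "real \<Rightarrow> real"
  assumes "a \<le> b" and cont: "continuous_on {a..b} w" and "w a \<le> 0"
    and der: "\<And>t. a \<le> t \<Longrightarrow> t < b \<Longrightarrow> \<exists>l<0. ((\<lambda>e. (w (t + e) - w t) / e) \<longlongrightarrow> l) (at_right 0)"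
  shows "w b \<le> 0"
proof (rule ccontr)
  assume wb: "\<not> w b \<le> 0"
  define S where "S = {t \<in> {a..b}. w t \<le> 0}"
  have "closed S"
    using continuous_closed_preimage[OF cont closed_atLeastAtMost closed_atMost[of 0]]
    by (simp add: S_def vimage_def Int_def)
  moreover have S: "a \<in> S" "S \<subseteq> {a..b}" using assms by (auto simp: S_def)
  ultimately have c: "Sup S \<in> S"
    by (intro closed_contains_Sup) (auto intro: bdd_above_mono)
  have cb: "a \<le> Sup S" "Sup S < b" using c wb by (auto simp: S_def less_le)
  have pos: "w t > 0" if "Sup S < t" "t \<le> b" for t
  proof (rule ccontr)
    assume "\<not> w t > 0"
    then have "t \<in> S" using that cb by (auto simp: S_def)
    then have "t \<le> Sup S" using S(2) by (intro cSup_upper) (auto intro: bdd_above_mono)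
    then show False using that by simp
  qed
  obtain l where l: "l < 0" "((\<lambda>e. (w (Sup S + e) - w (Sup S)) / e) \<longlongrightarrow> l) (at_right 0)"
    using der[OF cb] by blast
  have "\<forall>\<^sub>F e in at_right 0. (w (Sup S + e) - w (Sup S)) / e < 0"
    using l by (intro order_tendstoD(2)) auto
  moreover have "\<forall>\<^sub>F e in at_right 0. e < b - Sup S"
    using cb by (intro eventually_at_rightI[of 0 "b - Sup S"]) auto
  moreover have "\<forall>\<^sub>F e in at_right (0::real). 0 < e" by (rule eventually_at_right_less)
  ultimately have "\<forall>\<^sub>F e in at_right (0::real). False"
  proof eventually_elim
    case (elim e)
    then have "w (Sup S + e) > 0" by (intro pos) auto
    moreover have "w (Sup S) \<le> 0" using c by (simp add: S_def)
    ultimately show False using elim by (simp add: divide_less_0_iff)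
  qed
  then show False by simp
qed

lemma zero_right_derivative_imp_le:
  fixes k :: "real \<Rightarrow> real"
  assumes "a \<le> b" and cont: "continuous_on {a..b} k"
    and der: "\<And>t. a \<le> t \<Longrightarrow> t < b \<Longrightarrow> ((\<lambda>e. (k (t + e) - k t) / e) \<longlongrightarrow> 0) (at_right 0)"
  shows "k b \<le> k a"
proof (rule field_le_epsilon)
  fix \<delta> :: real assume "\<delta> > 0"
  \<comment> \<open>Subtracting a line of small slope makes the right derivative strictly negative; the summand
    one keeps the quotient meaningful for \<open>a = b\<close>.\<close>
  define e where "e = \<delta> / (b - a + 1)"
  have e: "e > 0" using \<open>\<delta> > 0\<close> assms(1) by (simp add: e_def)
  have "k b - k a - e * (b - a) \<le> 0"
  proof (rule nonpos_if_right_derivative_neg[of a b "\<lambda>t. k t - k a - e * (t - a)"])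
    show "continuous_on {a..b} (\<lambda>t. k t - k a - e * (t - a))" by (intro continuous_intros cont)
    fix t assume t: "a \<le> t" "t < b"
    have "((\<lambda>s. (k (t + s) - k t) / s - e) \<longlongrightarrow> 0 - e) (at_right 0)"
      by (intro tendsto_intros der t)
    then have "((\<lambda>s. (k (t + s) - k a - e * (t + s - a) - (k t - k a - e * (t - a))) / s) \<longlongrightarrow> 0 - e) (at_right 0)"
      by (rule Lim_transform_eventually)
         (use eventually_at_right_less[of 0] in \<open>eventually_elim, auto simp: field_simps\<close>)
    then show "\<exists>l<0. ((\<lambda>s. (k (t + s) - k a - e * (t + s - a) - (k t - k a - e * (t - a))) / s) \<longlongrightarrow> l) (at_right 0)"
      using e by (intro exI[of _ "0 - e"]) auto
  qed (use assms(1) in auto)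
  moreover have "e * (b - a) \<le> \<delta>"
    using assms(1) \<open>\<delta> > 0\<close> by (simp add: e_def field_simps)
  ultimately show "k b \<le> k a + \<delta>" by simp
qed

text \<open>The difference of \<open>f\<close> and the integral of \<open>g\<close> has right derivative zero, hence is constant.\<close>

lemma has_real_derivative_if_right_derivative:
  fixes f g :: "real \<Rightarrow> real"
  assumes f: "continuous_on {0..} f" and g: "continuous_on {0..} g"
    and der: "\<And>t. 0 \<le> t \<Longrightarrow> ((\<lambda>e. (f (t + e) - f t) / e) \<longlongrightarrow> g t) (at_right 0)"
    and "0 \<le> t"
  shows "(f has_real_derivative g t) (at t within {0..})"
proof -
  define I where "I t = integral {0..t} g" for t
  have dI: "(I has_real_derivative g t) (at t within {0..})" if "0 \<le> t" for t
  proof -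
    have "(I has_real_derivative g t) (at t within {0..t+1})"
      unfolding I_def using that by (intro integral_has_real_derivative continuous_on_subset[OF g]) auto
    moreover have "at t within {0..t+1} = at t within {0..}"
      by (rule at_within_nhd[of _ "{..<t+1}"]) auto
    ultimately show ?thesis by simp
  qed
  have cI: "continuous_on {0..} I" using dI by (auto intro!: DERIV_continuous_on)
  have rI: "((\<lambda>e. (I (t + e) - I t) / e) \<longlongrightarrow> g t) (at_right 0)" if "0 \<le> t" for t
  proof -
    have "(I has_real_derivative g t) (at t within {t<..})"
      using dI[OF that] by (rule DERIV_subset) (use that in auto)
    then have "((\<lambda>y. (I y - I t) / (y - t)) \<longlongrightarrow> g t) (at_right t)"
      by (simp add: has_field_derivative_iff)
    then show ?thesis by (simp add: filterlim_at_right_to_0[of _ _ t] add.commute)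
  qed
  have "f t - I t = f 0 - I 0" if "0 \<le> t" for t
  proof (rule antisym)
    have eq: "(f (s + e) - I (s + e) - (f s - I s)) / e = (f (s + e) - f s) / e - (I (s + e) - I s) / e"
      "(I (s + e) - f (s + e) - (I s - f s)) / e = (I (s + e) - I s) / e - (f (s + e) - f s) / e" for s e
      by (simp_all add: diff_divide_distrib)
    have d1: "((\<lambda>e. (f (s + e) - I (s + e) - (f s - I s)) / e) \<longlongrightarrow> 0) (at_right 0)"
      and d2: "((\<lambda>e. (I (s + e) - f (s + e) - (I s - f s)) / e) \<longlongrightarrow> 0) (at_right 0)" if "0 \<le> s" for s
      unfolding eq using tendsto_diff[OF der[OF that] rI[OF that]] tendsto_diff[OF rI[OF that] der[OF that]]
      by simp_all
    have c: "continuous_on {0..t} f" "continuous_on {0..t} I"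
      using continuous_on_subset[OF f] continuous_on_subset[OF cI] by auto
    show "f t - I t \<le> f 0 - I 0"
      using that c d1 by (intro zero_right_derivative_imp_le[of 0 t "\<lambda>t. f t - I t"] continuous_intros) auto
    have "I t - f t \<le> I 0 - f 0"
      using that c d2 by (intro zero_right_derivative_imp_le[of 0 t "\<lambda>t. I t - f t"] continuous_intros) auto
    then show "f 0 - I 0 \<le> f t - I t" by simp
  qed
  then have e: "f t = I t + (f 0 - I 0)" if "0 \<le> t" for t using that by (simp add: algebra_simps)
  have "((\<lambda>t. I t + (f 0 - I 0)) has_real_derivative g t) (at t within {0..})"
    using dI[OF \<open>0 \<le> t\<close>] by (auto intro!: derivative_eq_intros)
  then show ?thesis
  proof (rule has_field_derivative_transform_within[where d = 1])
    show "I s + (f 0 - I 0) = f s" if "s \<in> {0..}" for s using e[of s] that by simp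
  qed (use \<open>0 \<le> t\<close> in auto)
qed

text \<open>Continuity of the derivative is required in the measure for each fixed point only. In this form the
property applies to \<open>F\<close> and to the functions \<open>\<nu> \<mapsto> F'(\<nu>; y)\<close> alike.\<close>

definition dirac_C1 :: "('a::euclidean_space measure \<Rightarrow> real) \<Rightarrow> bool" where
  "dirac_C1 G \<longleftrightarrow> continuous_map weak_topology euclideanreal G \<and>
     (\<forall>\<mu>\<in>finite_measures. \<forall>x. deriv1_exists G \<mu> x) \<and>
     (\<forall>x. continuous_map weak_topology euclideanreal (\<lambda>\<mu>. deriv1 G \<mu> x))"

lemma tendsto_deriv1:
  assumes "deriv1_exists G \<mu> x"
  shows "((\<lambda>\<epsilon>. (G (add_dirac \<mu> \<epsilon> x) - G \<mu>) / \<epsilon>) \<longlongrightarrow> deriv1 G \<mu> x) (at_right 0)"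
proof -
  obtain l where l: "((\<lambda>\<epsilon>. (G (add_dirac \<mu> \<epsilon> x) - G \<mu>) / \<epsilon>) \<longlongrightarrow> l) (at_right 0)"
    using assms by (auto simp: deriv1_exists_def)
  then have "deriv1 G \<mu> x = l" unfolding deriv1_def by (intro tendsto_Lim) auto
  then show ?thesis using l by simp
qed

lemma deriv1I:
  assumes "((\<lambda>\<epsilon>. (G (add_dirac \<mu> \<epsilon> x) - G \<mu>) / \<epsilon>) \<longlongrightarrow> l) (at_right 0)"
  shows "deriv1_exists G \<mu> x" "deriv1 G \<mu> x = l"
  using assms by (auto simp: deriv1_exists_def deriv1_def intro: tendsto_Lim)

lemma continuous_map_add_dirac:
  assumes "\<mu> \<in> finite_measures"
  shows "continuous_map (top_of_set {0..}) weak_topology (\<lambda>t. add_dirac \<mu> t x)"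
proof (rule continuous_map_into_weak_topology)
  fix \<phi> :: "'a \<Rightarrow> real" assume \<phi>: "bounded_continuous \<phi>"
  have "continuous_on {0..} (\<lambda>t. (\<integral>y. \<phi> y \<partial>\<mu>) + t * \<phi> x)" by (intro continuous_intros)
  then have "continuous_on {0..} (\<lambda>t. \<integral>y. \<phi> y \<partial>add_dirac \<mu> t x)"
    by (rule continuous_on_eq) (simp add: integral_add_dirac[OF assms \<phi>])
  then show "continuous_map (top_of_set {0..}) euclideanreal (\<lambda>t. \<integral>y. \<phi> y \<partial>add_dirac \<mu> t x)"
    by simp
qed (simp add: add_dirac_in_finite_measures assms)

lemma has_derivative_along_dirac:
  assumes G: "dirac_C1 G" and \<mu>: "\<mu> \<in> finite_measures" and "0 \<le> t"
  shows "((\<lambda>t. G (add_dirac \<mu> t x)) has_real_derivative deriv1 G (add_dirac \<mu> t x) x) (at t within {0..})"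
proof (rule has_real_derivative_if_right_derivative[OF _ _ _ \<open>0 \<le> t\<close>])
  have c: "continuous_on {0..} (\<lambda>t. H (add_dirac \<mu> t x))"
    if "continuous_map weak_topology euclideanreal H" for H
    using continuous_map_compose[OF continuous_map_add_dirac[OF \<mu>] that] by (simp add: o_def)
  show "continuous_on {0..} (\<lambda>t. G (add_dirac \<mu> t x))"
    "continuous_on {0..} (\<lambda>t. deriv1 G (add_dirac \<mu> t x) x)"
    using G by (auto simp: dirac_C1_def intro!: c[of "\<lambda>\<mu>. deriv1 G \<mu> x"] c)
  fix s :: real assume s: "0 \<le> s"
  have "((\<lambda>e. (G (add_dirac (add_dirac \<mu> s x) e x) - G (add_dirac \<mu> s x)) / e)
      \<longlongrightarrow> deriv1 G (add_dirac \<mu> s x) x) (at_right 0)"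
    using G add_dirac_in_finite_measures[OF \<mu>] by (intro tendsto_deriv1) (simp add: dirac_C1_def)
  then show "((\<lambda>e. (G (add_dirac \<mu> (s + e) x) - G (add_dirac \<mu> s x)) / e)
      \<longlongrightarrow> deriv1 G (add_dirac \<mu> s x) x) (at_right 0)"
    by (rule Lim_transform_eventually)
       (use eventually_at_right_less[of 0] in \<open>eventually_elim, simp add: add_dirac_add_dirac[OF \<mu> s]\<close>)
qed

lemma mean_value_along_dirac:
  assumes G: "dirac_C1 G" and \<mu>: "\<mu> \<in> finite_measures" and "0 \<le> s"
  shows "\<exists>\<tau>. 0 \<le> \<tau> \<and> \<tau> \<le> s \<and> G (add_dirac \<mu> s x) - G \<mu> = s * deriv1 G (add_dirac \<mu> \<tau> x) x"
proof (cases "s = 0")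
  case False
  then have s: "0 < s" using \<open>0 \<le> s\<close> by simp
  have "((\<lambda>t. G (add_dirac \<mu> t x)) has_derivative (\<lambda>v. deriv1 G (add_dirac \<mu> t x) x * v)) (at t within {0..s})"
    if "0 \<le> t" "t \<le> s" for t
    using DERIV_subset[OF has_derivative_along_dirac[OF G \<mu> that(1)], of "{0..s}"]
    by (simp add: has_field_derivative_def)
  from mvt_simple[OF s this] obtain \<tau> where "\<tau> \<in> {0<..<s}"
    "G (add_dirac \<mu> s x) - G (add_dirac \<mu> 0 x) = deriv1 G (add_dirac \<mu> \<tau> x) x * (s - 0)" by blast
  then show ?thesis by (intro exI[of _ \<tau>]) (simp add: add_dirac_0[OF \<mu>] mult.commute)
qed (auto simp: add_dirac_0[OF \<mu>])

text \<open>Adding the atoms one at a time, each increment is given by the mean value theorem, and the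
intermediate measures at which the derivative is taken converge weakly to \<open>\<nu>\<close>.\<close>

lemma chain_rule_add_atoms:
  assumes G: "dirac_C1 G" and \<nu>: "\<nu> \<in> finite_measures" and c: "\<And>i. 0 \<le> c i"
  shows "((\<lambda>\<epsilon>. (G (add_atoms \<nu> (\<lambda>i. \<epsilon> * c i) \<xi> p) - G \<nu>) / \<epsilon>)
      \<longlongrightarrow> (\<Sum>i<p. c i * deriv1 G \<nu> (\<xi> i))) (at_right 0)"
proof (induction p)
  case (Suc p)
  let ?\<nu> = "\<lambda>\<epsilon>. add_atoms \<nu> (\<lambda>i. \<epsilon> * c i) \<xi> p"
  have "\<forall>\<epsilon>. \<exists>\<tau>. 0 \<le> \<epsilon> \<longrightarrow> 0 \<le> \<tau> \<and> \<tau> \<le> \<epsilon> * c p \<and>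
      G (add_dirac (?\<nu> \<epsilon>) (\<epsilon> * c p) (\<xi> p)) - G (?\<nu> \<epsilon>)
        = \<epsilon> * c p * deriv1 G (add_dirac (?\<nu> \<epsilon>) \<tau> (\<xi> p)) (\<xi> p)"
    using mean_value_along_dirac[OF G add_atoms_in_finite_measures[OF \<nu>]] c
    by (metis mult_nonneg_nonneg)
  then obtain \<tau> where \<tau>: "\<And>\<epsilon>. 0 \<le> \<epsilon> \<Longrightarrow> 0 \<le> \<tau> \<epsilon> \<and> \<tau> \<epsilon> \<le> \<epsilon> * c p"
    "\<And>\<epsilon>. 0 \<le> \<epsilon> \<Longrightarrow> G (add_dirac (?\<nu> \<epsilon>) (\<epsilon> * c p) (\<xi> p)) - G (?\<nu> \<epsilon>)
        = \<epsilon> * c p * deriv1 G (add_dirac (?\<nu> \<epsilon>) (\<tau> \<epsilon>) (\<xi> p)) (\<xi> p)" by metis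
  have pos: "\<forall>\<^sub>F \<epsilon> in at_right (0::real). 0 < \<epsilon>" by (rule eventually_at_right_less)
  have id0: "((\<lambda>\<epsilon>. \<epsilon>) \<longlongrightarrow> 0) (at_right (0::real))" by (rule tendsto_ident_at)
  \<comment> \<open>The choice \<open>\<tau>\<close> has no regularity of its own, but it is squeezed to zero.\<close>
  have \<tau>0: "(\<tau> \<longlongrightarrow> 0) (at_right 0)"
  proof (rule tendsto_sandwich[of "\<lambda>_. 0"])
    show "((\<lambda>\<epsilon>. \<epsilon> * c p) \<longlongrightarrow> 0) (at_right 0)"
      using tendsto_mult_left_zero[OF id0] by simp
    show "\<forall>\<^sub>F \<epsilon> in at_right 0. 0 \<le> \<tau> \<epsilon>" "\<forall>\<^sub>F \<epsilon> in at_right 0. \<tau> \<epsilon> \<le> \<epsilon> * c p"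
      using pos by (eventually_elim, simp add: \<tau>(1))+
  qed simp
  have "limitin weak_topology (\<lambda>\<epsilon>. add_dirac (?\<nu> \<epsilon>) (\<tau> \<epsilon>) (\<xi> p)) \<nu> (at_right 0)"
  proof (rule limitin_weak_topology[OF \<nu>])
    show "\<forall>\<^sub>F \<epsilon> in at_right 0. add_dirac (?\<nu> \<epsilon>) (\<tau> \<epsilon>) (\<xi> p) \<in> finite_measures"
      by (simp add: add_dirac_in_finite_measures add_atoms_in_finite_measures \<nu>)
    fix \<phi> :: "'a \<Rightarrow> real" assume \<phi>: "bounded_continuous \<phi>"
    have "((\<lambda>\<epsilon>. (\<integral>y. \<phi> y \<partial>\<nu>) + (\<Sum>i<p. \<epsilon> * c i * \<phi> (\<xi> i)) + \<tau> \<epsilon> * \<phi> (\<xi> p))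
        \<longlongrightarrow> (\<integral>y. \<phi> y \<partial>\<nu>) + (\<Sum>i<p. 0 * c i * \<phi> (\<xi> i)) + 0 * \<phi> (\<xi> p)) (at_right 0)"
      by (intro tendsto_intros \<tau>0 id0)
    then have "((\<lambda>\<epsilon>. (\<integral>y. \<phi> y \<partial>\<nu>) + (\<Sum>i<p. \<epsilon> * c i * \<phi> (\<xi> i)) + \<tau> \<epsilon> * \<phi> (\<xi> p))
        \<longlongrightarrow> (\<integral>y. \<phi> y \<partial>\<nu>)) (at_right 0)" by simp
    then show "((\<lambda>\<epsilon>. \<integral>y. \<phi> y \<partial>add_dirac (?\<nu> \<epsilon>) (\<tau> \<epsilon>) (\<xi> p)) \<longlongrightarrow> (\<integral>y. \<phi> y \<partial>\<nu>)) (at_right 0)"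
      by (rule Lim_transform_eventually)
         (use pos in \<open>eventually_elim, simp add: integral_add_dirac integral_add_atoms
           add_atoms_in_finite_measures \<nu> \<phi> c \<tau>(1)\<close>)
  qed
  then have "((\<lambda>\<epsilon>. deriv1 G (add_dirac (?\<nu> \<epsilon>) (\<tau> \<epsilon>) (\<xi> p)) (\<xi> p)) \<longlongrightarrow> deriv1 G \<nu> (\<xi> p)) (at_right 0)"
    using G by (intro tendsto_continuous_map_weak) (auto simp: dirac_C1_def)
  then have "((\<lambda>\<epsilon>. (G (?\<nu> \<epsilon>) - G \<nu>) / \<epsilon> + c p * deriv1 G (add_dirac (?\<nu> \<epsilon>) (\<tau> \<epsilon>) (\<xi> p)) (\<xi> p))
      \<longlongrightarrow> (\<Sum>i<p. c i * deriv1 G \<nu> (\<xi> i)) + c p * deriv1 G \<nu> (\<xi> p)) (at_right 0)"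
    by (intro tendsto_add tendsto_mult_left Suc.IH)
  then show ?case
    unfolding sum.lessThan_Suc
  proof (rule Lim_transform_eventually)
    show "\<forall>\<^sub>F \<epsilon> in at_right 0.
        (G (?\<nu> \<epsilon>) - G \<nu>) / \<epsilon> + c p * deriv1 G (add_dirac (?\<nu> \<epsilon>) (\<tau> \<epsilon>) (\<xi> p)) (\<xi> p)
        = (G (add_atoms \<nu> (\<lambda>i. \<epsilon> * c i) \<xi> (Suc p)) - G \<nu>) / \<epsilon>"
      using pos
    proof eventually_elim
      case (elim \<epsilon>)
      have "G (add_atoms \<nu> (\<lambda>i. \<epsilon> * c i) \<xi> (Suc p))
          = G (?\<nu> \<epsilon>) + \<epsilon> * c p * deriv1 G (add_dirac (?\<nu> \<epsilon>) (\<tau> \<epsilon>) (\<xi> p)) (\<xi> p)"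
        using \<tau>(2)[of \<epsilon>] elim by simp
      then show ?case using elim by (simp add: field_simps)
    qed
  qed
qed simp


section \<open>Functions of the masses of finitely many atoms\<close>

abbreviation atomic :: "nat \<Rightarrow> (nat \<Rightarrow> 'a::euclidean_space) \<Rightarrow> (nat \<Rightarrow> real) \<Rightarrow> 'a measure" where
  "atomic p \<xi> a \<equiv> add_atoms (null_measure borel) a \<xi> p"

lemma null_measure_in_finite_measures: "null_measure borel \<in> finite_measures"
  by (auto simp: finite_measures_def intro!: finite_measureI)

lemma topspace_orthant: "topspace (orthant p) = {x. (\<forall>i\<ge>p. x i = 0) \<and> (\<forall>i<p. 0 \<le> x i)}"
  by (auto simp: orthant_def topspace_Euclidean_space)

lemma continuous_map_atomic: "continuous_map (orthant p) weak_topology (atomic p \<xi>)"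
proof (rule continuous_map_into_weak_topology)
  fix \<phi> :: "'a \<Rightarrow> real" assume \<phi>: "bounded_continuous \<phi>"
  have "continuous_map (orthant p) euclideanreal (\<lambda>x. x i)" for i
    unfolding orthant_def Euclidean_space_def
    by (intro continuous_map_from_subtopology continuous_map_product_projection) simp
  then have "continuous_map (orthant p) euclideanreal (\<lambda>a. \<Sum>i<p. a i * \<phi> (\<xi> i))"
    by (intro continuous_map_sum continuous_map_real_mult) auto
  then show "continuous_map (orthant p) euclideanreal (\<lambda>a. \<integral>y. \<phi> y \<partial>atomic p \<xi> a)"
    by (rule continuous_map_eq)
       (simp add: integral_add_atoms null_measure_in_finite_measures \<phi> topspace_orthant)
qed (simp add: add_atoms_in_finite_measures null_measure_in_finite_measures)

lemma continuous_map_orthant: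
  assumes "continuous_map weak_topology euclideanreal G"
  shows "continuous_map (orthant p) euclideanreal (\<lambda>a. G (atomic p \<xi> a))"
  using continuous_map_compose[OF continuous_map_atomic assms] by (simp add: o_def)

lemma orthant_interiorD:
  assumes "x \<in> orthant_interior p"
  shows "i < p \<Longrightarrow> 0 < x i" "i < p \<Longrightarrow> 0 < t \<Longrightarrow> x(i := t) \<in> orthant_interior p"
  using assms by (auto simp: orthant_interior_def topspace_Euclidean_space)

text \<open>Moving along the coordinate \<open>i\<close> is moving along the half-line in the direction of the Dirac
measure at \<open>\<xi> i\<close> that starts where this coordinate vanishes; interior points of the orthant
are interior to that half-line. This turns one-sided derivatives into
two-sided ones.\<close>

lemma atomic_update:
  assumes "i < p"
  shows "atomic p \<xi> (x(i := t)) = add_dirac (atomic p \<xi> (x(i := 0))) t (\<xi> i)"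
proof (rule finite_measures_eqI)
  fix A :: "'a set" assume A: "A \<in> sets borel"
  have "(\<Sum>j<p. ennreal ((x(i := t)) j) * indicator A (\<xi> j))
      = ennreal t * indicator A (\<xi> i) + (\<Sum>j\<in>{..<p} - {i}. ennreal ((x(i := t)) j) * indicator A (\<xi> j))" for t
    using assms by (subst sum.remove[of _ i]) auto
  moreover have "(\<Sum>j\<in>{..<p} - {i}. ennreal ((x(i := t)) j) * indicator A (\<xi> j))
      = (\<Sum>j\<in>{..<p} - {i}. ennreal ((x(i := 0)) j) * indicator A (\<xi> j))"
    by (intro sum.cong) auto
  ultimately show "emeasure (atomic p \<xi> (x(i := t))) A
      = emeasure (add_dirac (atomic p \<xi> (x(i := 0))) t (\<xi> i)) A"
    using A by (simp add: emeasure_add_atoms emeasure_add_dirac add_atoms_in_finite_measures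
        null_measure_in_finite_measures add.commute del: fun_upd_apply)
qed (auto simp: add_atoms_in_finite_measures add_dirac_in_finite_measures null_measure_in_finite_measures)

lemma has_coord_derivative_atomic:
  assumes G: "dirac_C1 G" and x: "x \<in> orthant_interior p" and i: "i < p"
  shows "((\<lambda>t. G (atomic p \<xi> (x(i := t)))) has_real_derivative deriv1 G (atomic p \<xi> x) (\<xi> i)) (at (x i))"
proof -
  have xi: "0 < x i" using orthant_interiorD(1)[OF x i] .
  have "((\<lambda>t. G (add_dirac (atomic p \<xi> (x(i := 0))) t (\<xi> i))) has_real_derivative
      deriv1 G (add_dirac (atomic p \<xi> (x(i := 0))) (x i) (\<xi> i)) (\<xi> i)) (at (x i) within {0..})"
    using xi by (intro has_derivative_along_dirac[OF G])
      (auto simp: add_atoms_in_finite_measures null_measure_in_finite_measures)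
  moreover have "at (x i) within {0..} = at (x i)" using xi by (intro at_within_interior) auto
  ultimately show ?thesis
    unfolding atomic_update[OF i, where \<xi> = \<xi> and x = x, symmetric] by simp
qed

text \<open>The function \<open>v\<close> stands for a function of the masses or for one of its first partial derivatives,
once that is identified with a value of \<open>F'\<close> in the interior; so the lemma can be applied twice.\<close>

lemma coord_derivative_eq_deriv1:
  assumes G: "dirac_C1 G" and v: "\<And>y. y \<in> orthant_interior p \<Longrightarrow> v y = G (atomic p \<xi> y)"
    and x: "x \<in> orthant_interior p" and i: "i < p"
  shows "(\<lambda>t. v (x(i := t))) differentiable (at (x i))"
    and "deriv (\<lambda>t. v (x(i := t))) (x i) = deriv1 G (atomic p \<xi> x) (\<xi> i)"
proof -
  have "((\<lambda>t. v (x(i := t))) has_real_derivative deriv1 G (atomic p \<xi> x) (\<xi> i)) (at (x i))"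
    using has_coord_derivative_atomic[OF G x i]
    by (rule has_field_derivative_transform_within_open[of _ _ _ "{0<..}"])
       (use orthant_interiorD[OF x i] v in auto)
  then show "(\<lambda>t. v (x(i := t))) differentiable (at (x i))"
    "deriv (\<lambda>t. v (x(i := t))) (x i) = deriv1 G (atomic p \<xi> x) (\<xi> i)"
    by (auto simp: real_differentiable_def DERIV_imp_deriv)
qed

text \<open>In the interior the partial derivatives are \<open>F'\<close> and \<open>F''\<close> at atomic measures, and these
expressions are continuous up to the boundary of the orthant.\<close>

lemma C_orthant_atomic:
  assumes F: "continuous_map weak_topology euclideanreal F" and k: "k \<le> 2"
    and F1: "k \<ge> 1 \<Longrightarrow> dirac_C1 F" and F2: "\<And>y. k \<ge> 2 \<Longrightarrow> dirac_C1 (\<lambda>\<nu>. deriv1 F \<nu> y)"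
  shows "(\<lambda>a. F (atomic p \<xi> a)) \<in> C_orthant p k"
proof -
  let ?u = "\<lambda>a. F (atomic p \<xi> a)"
  have p1: "coord_partials [i] ?u x = deriv1 F (atomic p \<xi> x) (\<xi> i)"
    if "k \<ge> 1" "x \<in> orthant_interior p" "i < p" for i x
    using coord_derivative_eq_deriv1(2)[OF F1[OF that(1)] refl that(2,3)] by simp
  have p2: "coord_partials [j, i] ?u x = deriv1 (\<lambda>\<nu>. deriv1 F \<nu> (\<xi> i)) (atomic p \<xi> x) (\<xi> j)"
    if "k \<ge> 2" "x \<in> orthant_interior p" "i < p" "j < p" for i j x
  proof -
    have "deriv (\<lambda>t. coord_partials [i] ?u (x(j := t))) (x j)
        = deriv1 (\<lambda>\<nu>. deriv1 F \<nu> (\<xi> i)) (atomic p \<xi> x) (\<xi> j)"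
      using that by (intro coord_derivative_eq_deriv1(2)[OF F2[of "\<xi> i"] _ that(2,4)] p1) auto
    then show ?thesis by (simp only: coord_partials.simps)
  qed
  have "(\<lambda>t. coord_partials is ?u (x(i := t))) differentiable (at (x i))"
    if L: "set is \<subseteq> {..<p}" "length is < k" and x: "x \<in> orthant_interior p" "i < p" for "is" i x
  proof (cases "is")
    case Nil
    then show ?thesis using that coord_derivative_eq_deriv1(1)[OF F1 refl x] by simp
  next
    case (Cons j js)
    then have "is = [j]" "k \<ge> 2" "j < p" using that k by (cases js; auto)+
    then have "(\<lambda>t. coord_partials [j] ?u (x(i := t))) differentiable (at (x i))"
      by (intro coord_derivative_eq_deriv1(1)[where \<xi> = \<xi>, OF F2[of "\<xi> j"] _ x] p1) auto
    then show ?thesis using \<open>is = [j]\<close> by (simp only:)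
  qed
  moreover have "\<exists>v. continuous_map (orthant p) euclideanreal v \<and>
      (\<forall>x\<in>orthant_interior p. v x = coord_partials is ?u x)"
    if L: "set is \<subseteq> {..<p}" "length is \<le> k" for "is"
  proof -
    have "length is \<le> 2" using L(2) k by simp
    then consider "is = []" | i where "is = [i]" | j i where "is = [j, i]"
      by (cases "is" rule: remdups_adj.cases) auto
    then show ?thesis
    proof cases
      case 1
      then show ?thesis using continuous_map_orthant[OF F] by (intro exI[of _ ?u]) auto
    next
      case (2 i)
      then have "k \<ge> 1" "i < p" using L by auto
      then show ?thesis
        using continuous_map_orthant[of "\<lambda>\<mu>. deriv1 F \<mu> (\<xi> i)" p \<xi>] F1 p1 2
        by (intro exI[of _ "\<lambda>a. deriv1 F (atomic p \<xi> a) (\<xi> i)"]) (auto simp: dirac_C1_def simp del: coord_partials.simps)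
    next
      case (3 j i)
      then have "k \<ge> 2" "i < p" "j < p" using L by auto
      then show ?thesis
        using continuous_map_orthant[of "\<lambda>\<mu>. deriv1 (\<lambda>\<nu>. deriv1 F \<nu> (\<xi> i)) \<mu> (\<xi> j)" p \<xi>] F2 p2 3
        by (intro exI[of _ "\<lambda>a. deriv1 (\<lambda>\<nu>. deriv1 F \<nu> (\<xi> i)) (atomic p \<xi> a) (\<xi> j)"])
           (auto simp: dirac_C1_def simp del: coord_partials.simps)
    qed
  qed
  ultimately show ?thesis
    using continuous_map_orthant[OF F] by (auto simp: C_orthant_def)
qed

section \<open>Projection of measures onto the grid\<close>

definition node :: "real \<Rightarrow> nat \<Rightarrow> 'a::euclidean_space" where
  "node h = (SOME e. bij_betw e {..<card (nodes h :: 'a set)} (nodes h))"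

lemma bij_betw_node:
  assumes "h > 0"
  shows "bij_betw (node h) {..<card (nodes h :: 'a::euclidean_space set)} (nodes h :: 'a set)"
proof -
  have "\<exists>e. bij_betw e {..<card (nodes h :: 'a set)} (nodes h :: 'a set)"
    using ex_bij_betw_nat_finite[OF finite_nodes[OF assms]] by (simp add: atLeast0LessThan)
  then show ?thesis unfolding node_def by (rule someI_ex)
qed

lemma sum_node:
  assumes "h > 0"
  shows "(\<Sum>i<card (nodes h :: 'a::euclidean_space set). f (node h i)) = (\<Sum>z\<in>(nodes h :: 'a set). f z)"
  by (rule sum.reindex_bij_betw[OF bij_betw_node[OF assms]])

definition project :: "nat \<Rightarrow> real \<Rightarrow> 'a::euclidean_space measure \<Rightarrow> 'a measure" where
  "project m h \<mu> = atomic (card (nodes h :: 'a set)) (\<lambda>i. h *\<^sub>R node h i)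
     (\<lambda>i. \<integral>x. weight m h (node h i) x \<partial>\<mu>)"

lemma project_in_finite_measures: "project m h \<mu> \<in> finite_measures"
  by (simp add: project_def add_atoms_in_finite_measures null_measure_in_finite_measures)

lemma bounded_continuous_weight:
  assumes "h > 0"
  shows "bounded_continuous (weight m h z)"
proof -
  have "\<exists>M\<ge>0. \<forall>x. \<bar>weight m h z x\<bar> \<le> M"
    using partials_bounded_if_bounded_support[OF smooth_weight bounded_support_weight[OF assms], where m = 0]
    by (metis Nil_in_directions partials.simps(1))
  then show ?thesis
    using smooth_imp_continuous[OF smooth_weight] by (auto simp: bounded_continuous_def bounded_iff)
qed

lemma weight_in_test_functions:
  assumes "h > 0"
  shows "weight m h z \<in> test_functions"
  using weight_nonneg smooth_weight[of m h z] bounded_support_weight[OF assms, of m z]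
  by (auto simp: test_functions_def smooth_def)

lemma integral_weight_nonneg: "0 \<le> (\<integral>x. weight m h z x \<partial>\<mu>)"
  by (simp add: integral_nonneg_AE weight_nonneg)

text \<open>The projection of measures is dual to discretization of functions.\<close>

lemma integral_project:
  fixes \<mu> :: "'a::euclidean_space measure"
  assumes "h > 0" and \<mu>: "\<mu> \<in> finite_measures" and \<phi>: "bounded_continuous \<phi>"
  shows "(\<integral>y. \<phi> y \<partial>project m h \<mu>) = (\<integral>x. discretize m h \<phi> x \<partial>\<mu>)"
proof -
  have "(\<integral>y. \<phi> y \<partial>project m h \<mu>)
      = (\<Sum>i<card (nodes h :: 'a set). (\<lambda>z. (\<integral>x. weight m h z x \<partial>\<mu>) * \<phi> (h *\<^sub>R z)) (node h i))"
    unfolding project_def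
    by (subst integral_add_atoms[OF null_measure_in_finite_measures \<phi>]) (simp_all add: integral_weight_nonneg)
  also have "\<dots> = (\<Sum>z\<in>nodes h. (\<integral>x. weight m h z x \<partial>\<mu>) * \<phi> (h *\<^sub>R z))"
    by (rule sum_node[OF \<open>h > 0\<close>])
  also have "\<dots> = (\<Sum>z\<in>nodes h. (\<integral>x. weight m h z x * \<phi> (h *\<^sub>R z) \<partial>\<mu>))"
    by simp
  also have "\<dots> = (\<integral>x. (\<Sum>z\<in>nodes h. weight m h z x * \<phi> (h *\<^sub>R z)) \<partial>\<mu>)"
    by (intro Bochner_Integration.integral_sum[symmetric] integrable_mult_left
        bounded_continuous_integrable[OF \<mu> bounded_continuous_weight[OF \<open>h > 0\<close>]])
  also have "\<dots> = (\<integral>x. discretize m h \<phi> x \<partial>\<mu>)"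
    by (simp add: discretize_eq_sum[OF \<open>h > 0\<close>])
  finally show ?thesis .
qed

lemma abs_discretize_le:
  assumes "h > 0" and B: "\<And>y. \<bar>\<phi> y\<bar> \<le> B"
  shows "\<bar>discretize m h \<phi> x\<bar> \<le> B"
proof -
  have "B \<ge> 0" using B[of undefined] by linarith
  have "\<bar>discretize m h \<phi> x\<bar> \<le> (\<Sum>z\<in>nodes h. \<bar>weight m h z x * \<phi> (h *\<^sub>R z)\<bar>)"
    unfolding discretize_eq_sum[OF \<open>h > 0\<close>] by (rule sum_abs)
  also have "\<dots> \<le> (\<Sum>z\<in>nodes h. weight m h z x * B)"
    by (intro sum_mono) (simp add: abs_mult weight_nonneg B mult_left_mono)
  also have "\<dots> \<le> 1 * B"
    unfolding sum_distrib_right[symmetric]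
    by (intro mult_right_mono sum_weight_le_1 \<open>h > 0\<close> \<open>B \<ge> 0\<close>)
  finally show ?thesis by simp
qed

text \<open>By duality the mass of the projection is the integral of the discretized constant one.\<close>

lemma project_mass_le:
  fixes \<mu> :: "'a::euclidean_space measure"
  assumes h: "h > 0" and \<mu>: "\<mu> \<in> mass_le C"
  shows "project m h \<mu> \<in> mass_le C"
proof -
  have fm: "\<mu> \<in> finite_measures" "measure \<mu> UNIV \<le> C" using \<mu> by (auto simp: mass_le_def)
  have one: "bounded_continuous (\<lambda>_::'a. 1)" by (auto simp: bounded_continuous_def)
  have mass: "measure \<nu> UNIV = (\<integral>y. 1 \<partial>\<nu>)" if "\<nu> \<in> finite_measures" for \<nu> :: "'a measure"
    using finite_measuresD(2)[OF that] by simp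
  have "bounded_continuous (discretize m h (\<lambda>_::'a. 1))"
    using smooth_imp_continuous[OF smooth_discretize] abs_discretize_le[OF h, of "\<lambda>_. 1" 1]
    by (auto simp: bounded_continuous_def bounded_iff intro!: exI[of _ 1])
  then have "(\<integral>x. discretize m h (\<lambda>_::'a. 1) x \<partial>\<mu>) \<le> (\<integral>x. 1 \<partial>\<mu>)"
    using abs_discretize_le[OF h, of "\<lambda>_::'a. 1" 1]
    by (intro integral_mono bounded_continuous_integrable[OF fm(1)] one) (auto simp: abs_le_iff)
  then show ?thesis
    using fm integral_project[OF h fm(1) one, of m]
    by (simp add: mass_le_def project_in_finite_measures mass)
qed

lemma converges_continuously_pointwise:
  assumes "converges_continuously f l"
  shows "(\<lambda>n. f n x) \<longlonglongrightarrow> l x"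
proof (rule LIMSEQ_I)
  fix e :: real assume "e > 0"
  then obtain d N where "d > 0" "\<And>n y. n \<ge> N \<Longrightarrow> dist y x < d \<Longrightarrow> \<bar>f n y - l x\<bar> < e"
    using assms unfolding converges_continuously_def by meson
  then show "\<exists>N. \<forall>n\<ge>N. norm (f n x - l x) < e" by (intro exI[of _ N]) auto
qed

lemma converges_continuously_const:
  assumes "continuous_on UNIV f"
  shows "converges_continuously (\<lambda>_. f) f"
  using assms unfolding converges_continuously_def continuous_on_iff dist_real_def by (meson UNIV_I)

text \<open>By duality it suffices that discretizations of a bounded continuous function converge pointwise
and boundedly.\<close>

lemma project_converges:
  fixes \<mu> :: "'a::euclidean_space measure"
  assumes \<mu>: "\<mu> \<in> finite_measures"
  shows "limitin weak_topology (\<lambda>n. project m (mesh n) \<mu>) \<mu> sequentially"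
proof (rule limitin_weak_topology[OF \<mu>])
  fix \<phi> :: "'a \<Rightarrow> real" assume \<phi>: "bounded_continuous \<phi>"
  have sets: "sets \<mu> = sets borel" by (rule finite_measuresD[OF \<mu>])
  obtain B where B: "\<And>y. \<bar>\<phi> y\<bar> \<le> B" using \<phi> by (auto simp: bounded_continuous_def bounded_iff)
  have c: "continuous_on UNIV \<phi>" using \<phi> by (simp add: bounded_continuous_def)
  have "converges_continuously (\<lambda>n. partials [] (discretize m (mesh n) \<phi>)) \<phi>"
    using c by (intro partials_discretize_converge[where l = 0]) (auto simp: C_space_0 converges_continuously_const)
  then have lim: "(\<lambda>n. discretize m (mesh n) \<phi> x) \<longlonglongrightarrow> \<phi> x" for x
    using converges_continuously_pointwise by fastforce
  have "(\<lambda>n. \<integral>x. discretize m (mesh n) \<phi> x \<partial>\<mu>) \<longlonglongrightarrow> (\<integral>x. \<phi> x \<partial>\<mu>)"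
  proof (rule integral_dominated_convergence[where w = "\<lambda>_. B"])
    show "\<phi> \<in> borel_measurable \<mu>" "discretize m (mesh n) \<phi> \<in> borel_measurable \<mu>" for n
      using c smooth_imp_continuous[OF smooth_discretize[of m "mesh n" \<phi>], of UNIV] sets
      by (auto simp: borel_measurable_continuous_onI cong: measurable_cong_sets)
    show "integrable \<mu> (\<lambda>_. B)"
      by (rule bounded_continuous_integrable[OF \<mu>]) (auto simp: bounded_continuous_def)
    show "AE x in \<mu>. (\<lambda>n. discretize m (mesh n) \<phi> x) \<longlonglongrightarrow> \<phi> x" using lim by simp
    show "AE x in \<mu>. norm (discretize m (mesh n) \<phi> x) \<le> B" for n
      using abs_discretize_le[of "mesh n" \<phi> B] B by simp
  qed
  then show "(\<lambda>n. \<integral>x. \<phi> x \<partial>project m (mesh n) \<mu>) \<longlonglongrightarrow> (\<integral>x. \<phi> x \<partial>\<mu>)"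
    by (simp add: integral_project \<mu> \<phi>)
qed (simp add: project_in_finite_measures)

lemma continuous_convergence_of_jointly_continuous:
  assumes H: "continuous_map (prod_topology weak_topology euclidean) euclideanreal (\<lambda>(\<mu>, x). H \<mu> x)"
    and \<mu>: "limitin weak_topology \<mu>s \<mu> sequentially"
  shows "converges_continuously (\<lambda>n. H (\<mu>s n)) (H \<mu>)"
  unfolding converges_continuously_def
proof (intro allI impI)
  fix x :: 'b and e :: real assume e: "e > 0"
  let ?W = "{p \<in> topspace (prod_topology weak_topology euclidean). (case p of (\<nu>, y) \<Rightarrow> H \<nu> y) \<in> ball (H \<mu> x) e}"
  have "openin (prod_topology weak_topology euclidean) ?W"
    by (rule openin_continuous_map_preimage[OF H]) simp
  moreover have "(\<mu>, x) \<in> ?W"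
    using limitin_topspace[OF \<mu>] e by simp
  ultimately obtain U V where UV: "openin weak_topology U" "openin euclidean V" "\<mu> \<in> U" "x \<in> V" "U \<times> V \<subseteq> ?W"
    unfolding openin_prod_topology_alt by meson
  obtain d where d: "d > 0" "ball x d \<subseteq> V" using UV by (auto simp: open_contains_ball)
  obtain N where N: "\<And>n. n \<ge> N \<Longrightarrow> \<mu>s n \<in> U"
    using \<mu> UV(1,3) by (auto simp: limitin_def eventually_sequentially)
  have "\<bar>H (\<mu>s n) y - H \<mu> x\<bar> < e" if "n \<ge> N" "dist y x < d" for n y
  proof -
    have "y \<in> V" using d(2) that(2) by (auto simp: dist_commute)
    then have "(\<mu>s n, y) \<in> ?W" using N[OF that(1)] UV(5) by blast
    then show ?thesis by (simp add: dist_real_def abs_minus_commute)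
  qed
  then show "\<exists>d>0. \<exists>N. \<forall>n\<ge>N. \<forall>y. dist y x < d \<longrightarrow> \<bar>H (\<mu>s n) y - H \<mu> x\<bar> < e"
    using d(1) by blast
qed

lemma project_add_dirac:
  fixes x :: "'a::euclidean_space"
  assumes h: "h > 0" and \<mu>: "\<mu> \<in> finite_measures" and \<epsilon>: "\<epsilon> \<ge> 0"
  shows "project m h (add_dirac \<mu> \<epsilon> x)
    = add_atoms (project m h \<mu>) (\<lambda>i. \<epsilon> * weight m h (node h i) x) (\<lambda>i. h *\<^sub>R node h i)
        (card (nodes h :: 'a set))"
proof (rule finite_measures_eqI)
  fix A :: "'a set" assume A: "A \<in> sets borel"
  have "ennreal (\<integral>y. weight m h z y \<partial>add_dirac \<mu> \<epsilon> x)
      = ennreal (\<integral>y. weight m h z y \<partial>\<mu>) + ennreal (\<epsilon> * weight m h z x)" for z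
    unfolding integral_add_dirac[OF \<mu> bounded_continuous_weight[OF h] \<epsilon>]
    using \<epsilon> by (intro ennreal_plus integral_weight_nonneg mult_nonneg_nonneg weight_nonneg)
  then show "emeasure (project m h (add_dirac \<mu> \<epsilon> x)) A
    = emeasure (add_atoms (project m h \<mu>) (\<lambda>i. \<epsilon> * weight m h (node h i) x) (\<lambda>i. h *\<^sub>R node h i)
        (card (nodes h :: 'a set))) A"
    by (simp only: project_def emeasure_add_atoms[OF _ A] add_atoms_in_finite_measures
        null_measure_in_finite_measures distrib_right sum.distrib add.assoc)
qed (simp_all add: project_in_finite_measures add_atoms_in_finite_measures)

lemma deriv_project:
  fixes x :: "'a::euclidean_space"
  assumes h: "h > 0" and \<mu>: "\<mu> \<in> finite_measures" and G: "dirac_C1 G"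
  shows "((\<lambda>\<epsilon>. (G (project m h (add_dirac \<mu> \<epsilon> x)) - G (project m h \<mu>)) / \<epsilon>)
     \<longlongrightarrow> discretize m h (deriv1 G (project m h \<mu>)) x) (at_right 0)"
proof -
  have "(\<Sum>i<card (nodes h :: 'a set). weight m h (node h i) x * deriv1 G (project m h \<mu>) (h *\<^sub>R node h i))
      = discretize m h (deriv1 G (project m h \<mu>)) x"
    unfolding discretize_eq_sum[OF h]
    by (rule sum_node[OF h, of "\<lambda>z. weight m h z x * deriv1 G (project m h \<mu>) (h *\<^sub>R z)"])
  then have "((\<lambda>\<epsilon>. (G (add_atoms (project m h \<mu>) (\<lambda>i. \<epsilon> * weight m h (node h i) x) (\<lambda>i. h *\<^sub>R node h i)
      (card (nodes h :: 'a set))) - G (project m h \<mu>)) / \<epsilon>)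
     \<longlongrightarrow> discretize m h (deriv1 G (project m h \<mu>)) x) (at_right 0)"
    using chain_rule_add_atoms[where \<nu> = "project m h \<mu>" and c = "\<lambda>i. weight m h (node h i) x"
        and \<xi> = "\<lambda>i. h *\<^sub>R node h i" and p = "card (nodes h :: 'a set)",
        OF G project_in_finite_measures weight_nonneg] by simp
  then show ?thesis
    by (rule Lim_transform_eventually)
       (use eventually_at_right_less[of 0] in \<open>eventually_elim, simp add: project_add_dirac[OF h \<mu>]\<close>)
qed

lemma deriv1_project:
  assumes "h > 0" "\<mu> \<in> finite_measures" "dirac_C1 F"
  shows "deriv1_exists (\<lambda>\<mu>. F (project m h \<mu>)) \<mu> x"
    and "deriv1 (\<lambda>\<mu>. F (project m h \<mu>)) \<mu> x = discretize m h (deriv1 F (project m h \<mu>)) x"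
  using deriv1I[OF deriv_project[OF assms]] by auto

text \<open>The first derivative of the composition is, for fixed \<open>y\<close>, a finite combination of the functions
\<open>\<nu> \<mapsto> F'(\<nu>; hz)\<close> composed with the projection, so the first-order formula applies to each of
them.\<close>

lemma deriv2_project:
  fixes x y :: "'a::euclidean_space"
  assumes h: "h > 0" and \<mu>: "\<mu> \<in> finite_measures" and F: "dirac_C1 F"
    and F': "\<And>y. dirac_C1 (\<lambda>\<nu>. deriv1 F \<nu> y)"
  shows "deriv2_exists (\<lambda>\<mu>. F (project m h \<mu>)) \<mu> x y"
    and "deriv2 (\<lambda>\<mu>. F (project m h \<mu>)) \<mu> (x, y) = discretize m h (deriv2 F (project m h \<mu>)) (x, y)"
proof -
  let ?H = "\<lambda>\<nu>. deriv1 (\<lambda>\<mu>. F (project m h \<mu>)) \<nu> y"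
  have H: "?H \<nu> = (\<Sum>z\<in>nodes h. weight m h z y * deriv1 F (project m h \<nu>) (h *\<^sub>R z))"
    if "\<nu> \<in> finite_measures" for \<nu>
    using deriv1_project(2)[OF h that F, of m y] by (simp add: discretize_eq_sum[OF h])
  have "((\<lambda>\<epsilon>. \<Sum>z\<in>nodes h. weight m h z y *
      ((deriv1 F (project m h (add_dirac \<mu> \<epsilon> x)) (h *\<^sub>R z) - deriv1 F (project m h \<mu>) (h *\<^sub>R z)) / \<epsilon>))
      \<longlongrightarrow> (\<Sum>z\<in>nodes h. weight m h z y *
        discretize m h (deriv1 (\<lambda>\<nu>. deriv1 F \<nu> (h *\<^sub>R z)) (project m h \<mu>)) x)) (at_right 0)"
    by (intro tendsto_sum tendsto_mult_left deriv_project[OF h \<mu> F'])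
  also have "(\<lambda>\<epsilon>. \<Sum>z\<in>nodes h. weight m h z y *
      ((deriv1 F (project m h (add_dirac \<mu> \<epsilon> x)) (h *\<^sub>R z) - deriv1 F (project m h \<mu>) (h *\<^sub>R z)) / \<epsilon>))
      = (\<lambda>\<epsilon>. (?H (add_dirac \<mu> \<epsilon> x) - ?H \<mu>) / \<epsilon>)"
    by (simp add: H \<mu> add_dirac_in_finite_measures sum_subtractf[symmetric] sum_divide_distrib
        right_diff_distrib diff_divide_distrib)
  also have "(\<Sum>z\<in>nodes h. weight m h z y * discretize m h (deriv1 (\<lambda>\<nu>. deriv1 F \<nu> (h *\<^sub>R z)) (project m h \<mu>)) x)
      = (\<Sum>z\<in>nodes h. \<Sum>w\<in>nodes h. weight m h w x * weight m h z y * deriv2 F (project m h \<mu>) (h *\<^sub>R w, h *\<^sub>R z))"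
    by (simp add: discretize_eq_sum[OF h] sum_distrib_left deriv2_def mult_ac)
  also have "\<dots> = (\<Sum>w\<in>nodes h. \<Sum>z\<in>nodes h. weight m h w x * weight m h z y * deriv2 F (project m h \<mu>) (h *\<^sub>R w, h *\<^sub>R z))"
    by (rule sum.swap)
  also have "\<dots> = discretize m h (deriv2 F (project m h \<mu>)) (x, y)"
    unfolding discretize_eq_sum[OF h] nodes_pair sum.cartesian_product
    by (intro sum.cong) (auto simp: weight_pair)
  finally have "((\<lambda>\<epsilon>. (?H (add_dirac \<mu> \<epsilon> x) - ?H \<mu>) / \<epsilon>)
      \<longlongrightarrow> discretize m h (deriv2 F (project m h \<mu>)) (x, y)) (at_right 0)" .
  from deriv1I[OF this] show "deriv2_exists (\<lambda>\<mu>. F (project m h \<mu>)) \<mu> x y"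
    "deriv2 (\<lambda>\<mu>. F (project m h \<mu>)) \<mu> (x, y) = discretize m h (deriv2 F (project m h \<mu>)) (x, y)"
    by (auto simp: deriv2_exists_def deriv2_def)
qed

lemma dirac_C1_if_C_measures:
  fixes F :: "'a::euclidean_space measure \<Rightarrow> real"
  assumes "F \<in> C_measures k m"
  shows "continuous_map weak_topology euclideanreal F" "k \<ge> 1 \<Longrightarrow> dirac_C1 F"
    and "k \<ge> 2 \<Longrightarrow> dirac_C1 (\<lambda>\<nu>. deriv1 F \<nu> y)"
proof -
  have slice: "continuous_map weak_topology euclideanreal (\<lambda>\<mu>. H \<mu> z)"
    if "continuous_map (prod_topology weak_topology euclidean) euclideanreal (\<lambda>(\<mu>, x). H \<mu> x)"
    for H :: "'a measure \<Rightarrow> 'b::euclidean_space \<Rightarrow> real" and z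
  proof -
    have "continuous_map weak_topology (prod_topology weak_topology euclidean) (\<lambda>\<mu>. (\<mu>, z))"
      by (intro continuous_map_pairedI) auto
    from continuous_map_compose[OF this that] show ?thesis by (simp add: o_def)
  qed
  show F: "continuous_map weak_topology euclideanreal F" using assms by (simp add: C_measures_def)
  have c1: "continuous_map weak_topology euclideanreal (\<lambda>\<mu>. deriv1 F \<mu> x)" if "k \<ge> 1" for x
  proof (rule slice)
    have "continuous_map (prod_topology weak_topology euclidean) euclideanreal
        (\<lambda>(\<mu>, x). partials [] (deriv1 F \<mu>) x)"
      using assms that Nil_in_directions unfolding C_measures_def by blast
    then show "continuous_map (prod_topology weak_topology euclidean) euclideanreal
        (\<lambda>(\<mu>, x). deriv1 F \<mu> x)" by simp
  qed
  then show "k \<ge> 1 \<Longrightarrow> dirac_C1 F"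
    using assms F by (auto simp: dirac_C1_def C_measures_def)
  have c2: "continuous_map weak_topology euclideanreal (\<lambda>\<mu>. deriv2 F \<mu> (x, y))" if "k \<ge> 2" for x
  proof (rule slice)
    have "continuous_map (prod_topology weak_topology euclidean) euclideanreal
        (\<lambda>(\<mu>, z). partials [] (deriv2 F \<mu>) z)"
      using assms that Nil_in_directions unfolding C_measures_def by blast
    then show "continuous_map (prod_topology weak_topology euclidean) euclideanreal
        (\<lambda>(\<mu>, z). deriv2 F \<mu> z)" by simp
  qed
  show "dirac_C1 (\<lambda>\<nu>. deriv1 F \<nu> y)" if "k \<ge> 2"
    using c1 c2[OF that] assms that by (auto simp: dirac_C1_def C_measures_def deriv2_exists_def deriv2_def)
qed

lemma project_comp_in_C_P:
  fixes F :: "'a::euclidean_space measure \<Rightarrow> real"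
  assumes "k \<le> 2" "F \<in> C_measures k m" "h > 0"
  shows "(\<lambda>\<mu>. F (project l h \<mu>)) \<in> C_P k"
proof -
  let ?p = "card (nodes h :: 'a set)" and ?\<xi> = "\<lambda>i. h *\<^sub>R node h i :: 'a"
  have "(\<lambda>a. F (atomic ?p ?\<xi> a)) \<in> C_orthant ?p k"
    using dirac_C1_if_C_measures[OF assms(2)] assms(1) by (intro C_orthant_atomic)
  moreover have "project l h \<mu> = atomic ?p ?\<xi> (\<lambda>i. if i < ?p then \<integral>x. weight l h (node h i) x \<partial>\<mu> else 0)" for \<mu>
    unfolding project_def by (rule add_atoms_cong) simp
  ultimately show ?thesis
    unfolding C_P_def using weight_in_test_functions[OF assms(3)]
    by (intro CollectI exI[of _ ?p] exI[of _ "\<lambda>i. weight l h (node h i)"] exI[of _ "\<lambda>a. F (atomic ?p ?\<xi> a)"]) auto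
qed

lemma C_tendsto_discretize:
  fixes H :: "'a::euclidean_space measure \<Rightarrow> 'b::euclidean_space \<Rightarrow> real"
  assumes "limitin weak_topology \<mu>s \<mu> sequentially" "\<And>n. \<mu>s n \<in> finite_measures" "\<mu> \<in> finite_measures"
    and H: "\<And>\<mu>. \<mu> \<in> finite_measures \<Longrightarrow> H \<mu> \<in> C_space m"
    and c: "\<And>bs. bs \<in> directions m \<Longrightarrow>
      continuous_map (prod_topology weak_topology euclidean) euclideanreal (\<lambda>(\<mu>, x). partials bs (H \<mu>) x)"
  shows "C_tendsto m (\<lambda>n. discretize m (mesh n) (H (\<mu>s n))) (H \<mu>)"
  unfolding C_tendsto_def
proof (intro conjI allI ballI impI)
  show "discretize m (mesh n) (H (\<mu>s n)) \<in> C_space m" for n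
    using smooth_discretize by (auto simp: smooth_def)
  show "H \<mu> \<in> C_space m" using assms by simp
  fix bs :: "'b list" and K :: "'b set" assume bs: "bs \<in> directions m" and K: "compact K"
  have "converges_continuously (\<lambda>n. partials bs (H (\<mu>s n))) (partials bs (H \<mu>))"
    by (rule continuous_convergence_of_jointly_continuous[OF c[OF bs] assms(1)])
  then have "converges_continuously (\<lambda>n. partials bs (discretize m (mesh n) (H (\<mu>s n)))) (partials bs (H \<mu>))"
    by (intro partials_discretize_converge[OF _ order_refl bs] H assms(2))
  then show "uniform_limit K (\<lambda>n. partials bs (discretize m (mesh n) (H (\<mu>s n)))) (partials bs (H \<mu>)) sequentially"
    using K by (rule converges_continuously_imp_uniform_limit)
qed

lemma approximates_project:
  fixes F :: "'a::euclidean_space measure \<Rightarrow> real"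
  assumes k: "k \<le> 2" and F: "F \<in> C_measures k m"
  shows "approximates k m (\<lambda>n \<mu>. F (project m (mesh n) \<mu>)) F"
  unfolding approximates_def
proof (intro ballI conjI impI allI)
  fix \<mu> :: "'a measure" assume \<mu>: "\<mu> \<in> finite_measures"
  note lim = project_converges[OF \<mu>, of m]
  have h: "mesh n > 0" for n by simp
  show "(\<lambda>n. F (project m (mesh n) \<mu>)) \<longlonglongrightarrow> F \<mu>"
    by (rule tendsto_continuous_map_weak[OF dirac_C1_if_C_measures(1)[OF F] lim])
  show "deriv1_exists (\<lambda>\<mu>. F (project m (mesh n) \<mu>)) \<mu> x" if "k \<ge> 1" for n x
    by (rule deriv1_project[OF h \<mu> dirac_C1_if_C_measures(2)[OF F that]])
  show "C_tendsto m (\<lambda>n. deriv1 (\<lambda>\<mu>. F (project m (mesh n) \<mu>)) \<mu>) (deriv1 F \<mu>)" if "k \<ge> 1"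
  proof -
    have "deriv1 (\<lambda>\<mu>. F (project m (mesh n) \<mu>)) \<mu> = discretize m (mesh n) (deriv1 F (project m (mesh n) \<mu>))" for n
      by (rule ext) (rule deriv1_project[OF h \<mu> dirac_C1_if_C_measures(2)[OF F that]])
    then show ?thesis
      using F that C_tendsto_discretize[OF lim project_in_finite_measures \<mu>, of "deriv1 F" m]
      by (simp add: C_measures_def)
  qed
  show "deriv2_exists (\<lambda>\<mu>. F (project m (mesh n) \<mu>)) \<mu> x y" if "k = 2" for n x y
    using that by (intro deriv2_project[OF h \<mu>] dirac_C1_if_C_measures[OF F]) auto
  show "C_tendsto m (\<lambda>n. deriv2 (\<lambda>\<mu>. F (project m (mesh n) \<mu>)) \<mu>) (deriv2 F \<mu>)" if "k = 2"
  proof -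
    have "deriv2 (\<lambda>\<mu>. F (project m (mesh n) \<mu>)) \<mu> (x, y) = discretize m (mesh n) (deriv2 F (project m (mesh n) \<mu>)) (x, y)" for n x y
      using that by (intro deriv2_project[OF h \<mu>] dirac_C1_if_C_measures[OF F]) auto
    then have "deriv2 (\<lambda>\<mu>. F (project m (mesh n) \<mu>)) \<mu> = discretize m (mesh n) (deriv2 F (project m (mesh n) \<mu>))" for n
      by (auto simp: fun_eq_iff)
    then show ?thesis
      using F that C_tendsto_discretize[OF lim project_in_finite_measures \<mu>, of "deriv2 F" m]
      by (simp add: C_measures_def)
  qed
qed

text \<open>Projections do not increase the mass, so the bounds on measures of mass at most \<open>C\<close> hold for the
projected measures, at which the derivatives are evaluated.\<close>

lemma discretize_family_bounded:
  fixes D :: "'a::euclidean_space measure \<Rightarrow> 'b::euclidean_space \<Rightarrow> real"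
  assumes D: "\<And>\<mu>. \<mu> \<in> finite_measures \<Longrightarrow> D \<mu> \<in> C_space m"
    and b: "\<And>bs. bs \<in> directions m \<Longrightarrow> bounded {partials bs (D \<mu>) x | \<mu> x. \<mu> \<in> mass_le C}"
  shows "\<exists>R. \<forall>n \<mu> x. \<forall>bs\<in>directions m. \<mu> \<in> mass_le C \<longrightarrow>
    \<bar>partials bs (discretize m (mesh n) (D (project m (mesh n) \<mu>))) x\<bar> \<le> R"
proof -
  have "\<exists>M. \<forall>bs\<in>directions m. \<forall>\<mu>\<in>mass_le C. \<forall>x. \<bar>partials bs (D \<mu>) x\<bar> \<le> M bs"
  proof -
    have "\<exists>M. \<forall>\<mu>\<in>mass_le C. \<forall>x. \<bar>partials bs (D \<mu>) x\<bar> \<le> M" if "bs \<in> directions m" for bs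
      using b[OF that] by (fastforce simp: bounded_iff)
    then show ?thesis by metis
  qed
  then obtain M where M: "\<And>bs \<mu> x. bs \<in> directions m \<Longrightarrow> \<mu> \<in> mass_le C \<Longrightarrow> \<bar>partials bs (D \<mu>) x\<bar> \<le> M bs" by blast
  obtain B where B: "\<And>h M bs x g. 0 < h \<Longrightarrow> h \<le> 1 \<Longrightarrow> g \<in> C_space m \<Longrightarrow> bs \<in> directions m \<Longrightarrow>
       (\<And>cs y. cs \<in> directions m \<Longrightarrow> \<bar>partials cs g y\<bar> \<le> M) \<Longrightarrow>
       \<bar>partials bs (discretize m h g) (x::'b)\<bar> \<le> B * M"
    using partials_discretize_bound[where 'a = 'b] by metis
  let ?M = "\<Sum>bs\<in>directions m. \<bar>M bs\<bar>"
  have "\<bar>partials bs (discretize m (mesh n) (D (project m (mesh n) \<mu>))) x\<bar> \<le> B * ?M"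
    if bs: "bs \<in> directions m" and \<mu>: "\<mu> \<in> mass_le C" for n \<mu> x bs
  proof (rule B)
    show "D (project m (mesh n) \<mu>) \<in> C_space m" by (intro D project_in_finite_measures)
    fix cs :: "'b list" and y assume cs: "cs \<in> directions m"
    have "\<bar>partials cs (D (project m (mesh n) \<mu>)) y\<bar> \<le> M cs"
      using \<mu> by (intro M cs project_mass_le) auto
    also have "\<dots> \<le> \<bar>M cs\<bar>" by simp
    also have "\<dots> \<le> ?M" using cs by (intro member_le_sum) (auto simp: finite_directions)
    finally show "\<bar>partials cs (D (project m (mesh n) \<mu>)) y\<bar> \<le> ?M" .
  qed (use bs in auto)
  then show ?thesis by blast
qed

lemma bounded_family_project:
  fixes F :: "'a::euclidean_space measure \<Rightarrow> real"
  assumes k: "k \<le> 2" and F: "F \<in> C_measures k m" and b: "bounded_family k m C {F}"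
  shows "bounded_family k m C (range (\<lambda>n \<mu>. F (project m (mesh n) \<mu>)))"
proof -
  let ?F = "\<lambda>n \<mu>. F (project m (mesh n) \<mu>)"
  have h: "mesh n > 0" for n by simp
  have fm: "\<mu> \<in> finite_measures" if "\<mu> \<in> mass_le C" for \<mu> :: "'a measure"
    using that by (simp add: mass_le_def)
  have "bounded {G \<mu> |G \<mu>. G \<in> range ?F \<and> \<mu> \<in> mass_le C}"
  proof (rule bounded_subset)
    show "bounded {G \<mu> |G \<mu>. G \<in> {F} \<and> \<mu> \<in> mass_le C}" using b by (simp add: bounded_family_def)
    show "{G \<mu> |G \<mu>. G \<in> range ?F \<and> \<mu> \<in> mass_le C} \<subseteq> {G \<mu> |G \<mu>. G \<in> {F} \<and> \<mu> \<in> mass_le C}"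
      using project_mass_le[OF h] by blast
  qed
  moreover have "bounded {partials bs (deriv1 G \<mu>) x |G \<mu> x. G \<in> range ?F \<and> \<mu> \<in> mass_le C}"
    if k1: "k \<ge> 1" and bs: "bs \<in> directions m" for bs
  proof -
    have e: "deriv1 (?F n) \<mu> = discretize m (mesh n) (deriv1 F (project m (mesh n) \<mu>))" if "\<mu> \<in> mass_le C" for n \<mu>
      by (rule ext) (rule deriv1_project[OF h fm[OF that] dirac_C1_if_C_measures(2)[OF F k1]])
    obtain R where R: "\<forall>n \<mu> x. \<forall>bs\<in>directions m. \<mu> \<in> mass_le C \<longrightarrow>
        \<bar>partials bs (discretize m (mesh n) (deriv1 F (project m (mesh n) \<mu>))) x\<bar> \<le> R"
      using discretize_family_bounded[of "deriv1 F" m C] F b k1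
      by (auto simp: C_measures_def bounded_family_def)
    show ?thesis
      unfolding bounded_iff using R bs e by (intro exI[of _ R]) auto
  qed
  moreover have "bounded {partials bs (deriv2 G \<mu>) z |G \<mu> z. G \<in> range ?F \<and> \<mu> \<in> mass_le C}"
    if k2: "k = 2" and bs: "bs \<in> directions m" for bs
  proof -
    have "deriv2 (?F n) \<mu> (x, y) = discretize m (mesh n) (deriv2 F (project m (mesh n) \<mu>)) (x, y)" if "\<mu> \<in> mass_le C" for n \<mu> x y
      using k2 by (intro deriv2_project[OF h fm[OF that]] dirac_C1_if_C_measures[OF F]) auto
    then have e: "deriv2 (?F n) \<mu> = discretize m (mesh n) (deriv2 F (project m (mesh n) \<mu>))" if "\<mu> \<in> mass_le C" for n \<mu>
      using that by (auto simp: fun_eq_iff)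
    obtain R where R: "\<forall>n \<mu> x. \<forall>bs\<in>directions m. \<mu> \<in> mass_le C \<longrightarrow>
        \<bar>partials bs (discretize m (mesh n) (deriv2 F (project m (mesh n) \<mu>))) x\<bar> \<le> R"
      using discretize_family_bounded[of "deriv2 F" m C] F b k2
      by (auto simp: C_measures_def bounded_family_def)
    show ?thesis
      unfolding bounded_iff using R bs e by (intro exI[of _ R]) auto
  qed
  ultimately show ?thesis by (simp add: bounded_family_def)
qed

theorem theorem5:
  fixes F :: "(real ^ 'd) measure \<Rightarrow> real" and k m :: nat
  assumes "k \<in> {0, 1, 2}" and "F \<in> C_measures k m"
  shows "(\<exists>Fn. (\<forall>n. Fn n \<in> C_P k) \<and> approximates k m Fn F) \<and>
         (\<forall>C>0. bounded_family k m C {F} \<longrightarrow>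
            (\<exists>Fn. (\<forall>n. Fn n \<in> C_P k) \<and> approximates k m Fn F \<and> bounded_family k m C (range Fn)))"
proof -
  let ?F = "\<lambda>n \<mu>. F (project m (mesh n) \<mu>)"
  have k: "k \<le> 2" using assms(1) by auto
  have "\<forall>n. ?F n \<in> C_P k"
    by (intro allI project_comp_in_C_P[OF k assms(2)]) simp
  moreover have "approximates k m ?F F"
    by (rule approximates_project[OF k assms(2)])
  ultimately show ?thesis
    by (intro conjI allI impI exI[of _ ?F]) (auto intro: bounded_family_project[OF k assms(2)])
qed

end
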